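(* For a generic Gough-Stewart platform, the regular mapping $\mathrm{Rec}:\Sigma\to Q$ is a birational equivalence from $\Sigma$ to the quadric surface $Q\subset\mathbb{P}^5(K)$, defined over $K=\mathbb{R}(\mathrm{SO}(3))$.
   Context: A Gough-Stewart platform (its architecture) is given by vectors $A_1,\dots,A_6\in\mathbb{R}^3$ and $b_1,\dots,b_6\in\mathbb{R}^3$; frames are chosen so that $A_1=b_1=0$. "Generic" means: for all architectures in some nonempty Zariski open subset of the real parameter space of architectures. Let $K=\mathbb{R}(\mathrm{SO}(3))$ be the field of rational functions on $\mathrm{SO}(3)$ and let $R$ be the generic rotation matrix (its entries are the coordinate functions in $K$). Dot product, cross product and mixed product $[U,V,W]=\det(U,V,W)$ are defined over $K$ by the usual formulas. Put $B_i=Rb_i$, $C_i=B_i-A_i$, $P=(x,y,z)^{\mathsf T}$, and let $\mathrm{Jac}$ be the $6\times6$ matrix whose $i$-th row is $\big((C_i+P)^{\mathsf T},(A_i\times(C_i+P))^{\mathsf T}\big)$ (Plücker coordinates of the $i$-th limb). $\Sigma$ is the surface $\det(\mathrm{Jac})=0$ in affine 3-space over $K$ with coordinates $x,y,z$; for a generic platform it is a nonsingular cubic surface. A twist $\begin{pmatrix} \Omega \\ V \end{pmatrix}$ ($\Omega,V$ 3-dimensional) is reciprocal to the limbs at $P$ if $(C_i+P)\cdot V+(A_i\times(C_i+P))\cdot\Omega=0$ for $i=1,\dots,6$. When $\Sigma$ is nonsingular, $\mathrm{Jac}$ has rank 5 at each point of $\Sigma$, and $\mathrm{Rec}:\Sigma\to\mathbb{P}^5(K)$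 is the regular mapping sending $P$ to the line of twists reciprocal to the limbs at $P$. Its image lies in the quadric surface $Q$ defined as follows: indices are ordered so that $A_5=\sum_{i=2}^4\alpha_iA_i$ and $A_6=\sum_{i=2}^4\beta_iA_i$ with $\alpha_i,\beta_i\in\mathbb{R}$, and $Q\subset\mathbb{P}^5(K)$ is given, in homogeneous coordinates $(\Omega,V)$, by $$V\cdot\Big(C_5-\sum_{i=2}^4\alpha_iC_i\Big)+[\Omega,A_5,C_5]-\sum_{i=2}^4\alpha_i[\Omega,A_i,C_i]=0,$$ $$V\cdot\Big(C_6-\sum_{i=2}^4\beta_iC_i\Big)+[\Omega,A_6,C_6]-\sum_{i=2}^4\beta_i[\Omega,A_i,C_i]=0,$$ $$[\Omega,A_3,A_4](V\cdot C_2+[\Omega,A_2,C_2])+[\Omega,A_4,A_2](V\cdot C_3+[\Omega,A_3,C_3])+[\Omega,A_2,A_3](V\cdot C_4+[\Omega,A_4,C_4])=0.$$ *)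

theory Defs
  imports "HOL-Analysis.Analysis" "HOL-Algebra.Algebraic_Closure_Type"
begin

(* it clashes with the notation for vector components *)
no_notation fps_nth (infixl \<open>$\<close> 75)

section \<open>Polynomial functions\<close>

text \<open>
  \<open>poly_funs k coords\<close> consists of the functions that are polynomials, with coefficients in \<open>k\<close>, in the
  coordinate functions \<open>coords\<close>.
\<close>

inductive_set poly_funs :: "'a::comm_ring_1 set \<Rightarrow> ('x \<Rightarrow> 'a) set \<Rightarrow> ('x \<Rightarrow> 'a) set"
  for k :: "'a set" and coords :: "('x \<Rightarrow> 'a) set" where
  const: "c \<in> k \<Longrightarrow> (\<lambda>_. c) \<in> poly_funs k coords"
| coord: "\<xi> \<in> coords \<Longrightarrow> \<xi> \<in> poly_funs k coords"
| add: "f \<in> poly_funs k coords \<Longrightarrow> g \<in> poly_funs k coords \<Longrightarrow> (\<lambda>x. f x + g x) \<in> poly_funs k coords"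
| mult: "f \<in> poly_funs k coords \<Longrightarrow> g \<in> poly_funs k coords \<Longrightarrow> (\<lambda>x. f x * g x) \<in> poly_funs k coords"


section \<open>The function field of SO(3)\<close>

typedef so3 = "{M :: real^3^3. rotation_matrix M}"
  by (rule exI[of _ "mat 1"]) (simp add: rotation_matrix_def orthogonal_matrix_id)

setup_lifting type_definition_so3

definition so3_entries :: "(so3 \<Rightarrow> real) set" where
  "so3_entries = {\<lambda>M. Rep_so3 M $ i $ j | i j. True}"

typedef so3_ring = "poly_funs UNIV so3_entries"
  morphisms so3_fun Abs_so3_ring
  by (rule exI[of _ "\<lambda>_. 0"]) (rule poly_funs.const, simp)

setup_lifting type_definition_so3_ring

text \<open>
  The coordinate ring is an integral domain: two rotations are joined by the image of a line under
  the parametrisation of rotations by quaternions.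
\<close>

definition quat_mat :: "real \<Rightarrow> real \<Rightarrow> real \<Rightarrow> real \<Rightarrow> real^3^3" where
  "quat_mat w x y z = (let n = w\<^sup>2 + x\<^sup>2 + y\<^sup>2 + z\<^sup>2 in
     vector [vector [(w\<^sup>2 + x\<^sup>2 - y\<^sup>2 - z\<^sup>2) / n, 2 * (x * y - w * z) / n, 2 * (x * z + w * y) / n],
             vector [2 * (x * y + w * z) / n, (w\<^sup>2 - x\<^sup>2 + y\<^sup>2 - z\<^sup>2) / n, 2 * (y * z - w * x) / n],
             vector [2 * (x * z - w * y) / n, 2 * (y * z + w * x) / n, (w\<^sup>2 - x\<^sup>2 - y\<^sup>2 + z\<^sup>2) / n]])"

lemma rotation_matrix_quat_mat:
  assumes "w\<^sup>2 + x\<^sup>2 + y\<^sup>2 + z\<^sup>2 \<noteq> (0::real)"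
  shows "rotation_matrix (quat_mat w x y z)"
proof -
  define n where "n = w\<^sup>2 + x\<^sup>2 + y\<^sup>2 + z\<^sup>2"
  have n: "n \<noteq> 0" using assms n_def by simp
  define a b c d e f g h i where
    entries: "a = w\<^sup>2 + x\<^sup>2 - y\<^sup>2 - z\<^sup>2" "b = 2 * (x * y - w * z)" "c = 2 * (x * z + w * y)"
    "d = 2 * (x * y + w * z)" "e = w\<^sup>2 - x\<^sup>2 + y\<^sup>2 - z\<^sup>2" "f = 2 * (y * z - w * x)"
    "g = 2 * (x * z - w * y)" "h = 2 * (y * z + w * x)" "i = w\<^sup>2 - x\<^sup>2 - y\<^sup>2 + z\<^sup>2"
  have M: "quat_mat w x y z = vector [vector [a / n, b / n, c / n], vector [d / n, e / n, f / n],
    vector [g / n, h / n, i / n]]"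
    unfolding quat_mat_def Let_def entries n_def ..
  have cols: "a*a + d*d + g*g = n*n" "b*b + e*e + h*h = n*n" "c*c + f*f + i*i = n*n"
    "a*b + d*e + g*h = 0" "a*c + d*f + g*i = 0" "b*c + e*f + h*i = 0"
    unfolding entries n_def by (simp_all add: power2_eq_square algebra_simps)
  have rows: "a*a + b*b + c*c = n*n" "d*d + e*e + f*f = n*n" "g*g + h*h + i*i = n*n"
    "a*d + b*e + c*f = 0" "a*g + b*h + c*i = 0" "d*g + e*h + f*i = 0"
    unfolding entries n_def by (simp_all add: power2_eq_square algebra_simps)
  have adj: "e*i - f*h = n*a" "f*g - d*i = n*b" "d*h - e*g = n*c"
    unfolding entries n_def by (simp_all add: power2_eq_square algebra_simps)
  have "orthogonal_matrix (quat_mat w x y z)"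
    unfolding orthogonal_matrix_def M using rows cols n
    by (simp add: vec_eq_iff forall_3 matrix_matrix_mult_def sum_3 transpose_def mat_def
        mult.commute flip: add_divide_distrib)
  moreover have "det (quat_mat w x y z) = 1"
  proof -
    have "det (quat_mat w x y z) = (a * (e*i - f*h) + b * (f*g - d*i) + c * (d*h - e*g)) / (n * n * n)"
      unfolding M by (simp add: det_3 n) (simp add: field_simps n)
    also have "\<dots> = n * (a*a + b*b + c*c) / (n * n * n)"
      unfolding adj by (simp add: algebra_simps)
    finally show ?thesis using rows n by simp
  qed
  ultimately show ?thesis by (simp add: rotation_matrix_def)
qed

lemma rotation_matrix_is_quat_mat:
  assumes "rotation_matrix M"
  obtains w x y z where "w\<^sup>2 + x\<^sup>2 + y\<^sup>2 + z\<^sup>2 \<noteq> (0::real)" "M = quat_mat w x y z"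
proof -
  define a b c d e f g h i where M: "a = M$1$1" "b = M$1$2" "c = M$1$3"
    "d = M$2$1" "e = M$2$2" "f = M$2$3" "g = M$3$1" "h = M$3$2" "i = M$3$3"
  have orth: "orthogonal_matrix M"
    using assms by (simp add: rotation_matrix_def)
  have rows: "a*a + b*b + c*c = 1" "d*d + e*e + f*f = 1" "g*g + h*h + i*i = 1"
    "a*d + b*e + c*f = 0" "a*g + b*h + c*i = 0" "d*g + e*h + f*i = 0"
    and cols: "a*a + d*d + g*g = 1" "b*b + e*e + h*h = 1" "c*c + f*f + i*i = 1"
    "a*b + d*e + g*h = 0" "a*c + d*f + g*i = 0" "b*c + e*f + h*i = 0"
    using orth unfolding orthogonal_matrix_def M
    by (simp_all add: vec_eq_iff forall_3 matrix_matrix_mult_def sum_3 transpose_def mat_def algebra_simps)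
  have cross: "cross3 (M *v x) (M *v y) = M *v (cross3 x y)" for x y
    using assms by (rule cross_rotation_matrix)
  have adj: "e*i - f*h = a" "f*g - d*i = b" "d*h - e*g = c" "c*h - b*i = d" "a*i - c*g = e"
    "b*g - a*h = f" "b*f - c*e = g" "c*d - a*f = h" "a*e - b*d = i"
    using cross[of "axis 1 1" "axis 2 1"] cross[of "axis 2 1" "axis 3 1"] cross[of "axis 3 1" "axis 1 1"]
    unfolding M
    by (simp_all add: matrix_vector_mult_basis column_def cross3_def axis_def vec_eq_iff forall_3
        vector_3 matrix_vector_mult_def sum_3 mult.commute)
  have qm: "M = quat_mat w x y z"
    if n: "w\<^sup>2 + x\<^sup>2 + y\<^sup>2 + z\<^sup>2 = 4 * s" "s \<noteq> 0"
      and "w\<^sup>2 = s * (1 + a + e + i)" "x\<^sup>2 = s * (1 + a - e - i)"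
        "y\<^sup>2 = s * (1 - a + e - i)" "z\<^sup>2 = s * (1 - a - e + i)"
        "w * x = s * (h - f)" "w * y = s * (c - g)" "w * z = s * (d - b)"
        "x * y = s * (b + d)" "x * z = s * (c + g)" "y * z = s * (f + h)" for w x y z s
    unfolding quat_mat_def Let_def n(1) that(3-)
    using n(2) by (simp add: vec_eq_iff forall_3 M) (simp add: field_simps)
  have "1 + a + e + i \<noteq> 0 \<or> 1 + a - e - i \<noteq> 0 \<or> 1 - a + e - i \<noteq> 0 \<or> 1 - a - e + i \<noteq> 0"
    by linarith
  then show thesis
  proof (elim disjE)
    assume s: "1 + a + e + i \<noteq> 0"
    have n: "(1 + a + e + i)\<^sup>2 + (h - f)\<^sup>2 + (c - g)\<^sup>2 + (d - b)\<^sup>2 = 4 * (1 + a + e + i)"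
      using rows cols adj by (simp add: power2_eq_square algebra_simps)
    have "M = quat_mat (1 + a + e + i) (h - f) (c - g) (d - b)"
      by (rule qm[OF n s]) (insert rows cols adj, simp_all add: power2_eq_square algebra_simps)
    then show thesis using s n by (intro that[of "1 + a + e + i" "h - f" "c - g" "d - b"]) simp_all
  next
    assume s: "1 + a - e - i \<noteq> 0"
    have n: "(h - f)\<^sup>2 + (1 + a - e - i)\<^sup>2 + (b + d)\<^sup>2 + (c + g)\<^sup>2 = 4 * (1 + a - e - i)"
      using rows cols adj by (simp add: power2_eq_square algebra_simps)
    have "M = quat_mat (h - f) (1 + a - e - i) (b + d) (c + g)"
      by (rule qm[OF n s]) (insert rows cols adj, simp_all add: power2_eq_square algebra_simps)
    then show thesis using s n by (intro that[of "h - f" "1 + a - e - i" "b + d" "c + g"]) simp_all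
  next
    assume s: "1 - a + e - i \<noteq> 0"
    have n: "(c - g)\<^sup>2 + (b + d)\<^sup>2 + (1 - a + e - i)\<^sup>2 + (f + h)\<^sup>2 = 4 * (1 - a + e - i)"
      using rows cols adj by (simp add: power2_eq_square algebra_simps)
    have "M = quat_mat (c - g) (b + d) (1 - a + e - i) (f + h)"
      by (rule qm[OF n s]) (insert rows cols adj, simp_all add: power2_eq_square algebra_simps)
    then show thesis using s n by (intro that[of "c - g" "b + d" "1 - a + e - i" "f + h"]) simp_all
  next
    assume s: "1 - a - e + i \<noteq> 0"
    have n: "(d - b)\<^sup>2 + (c + g)\<^sup>2 + (f + h)\<^sup>2 + (1 - a - e + i)\<^sup>2 = 4 * (1 - a - e + i)"
      using rows cols adj by (simp add: power2_eq_square algebra_simps)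
    have "M = quat_mat (d - b) (c + g) (f + h) (1 - a - e + i)"
      by (rule qm[OF n s]) (insert rows cols adj, simp_all add: power2_eq_square algebra_simps)
    then show thesis using s n by (intro that[of "d - b" "c + g" "f + h" "1 - a - e + i"]) simp_all
  qed
qed

lemma so3_poly_funs_no_zero_divisors:
  assumes f: "f \<in> poly_funs UNIV so3_entries" and g: "g \<in> poly_funs UNIV so3_entries"
    and fM: "f M \<noteq> 0" and gN: "g N \<noteq> 0"
  shows "\<exists>P. f P * g P \<noteq> 0"
proof -
  obtain w1 x1 y1 z1 where M: "w1\<^sup>2 + x1\<^sup>2 + y1\<^sup>2 + z1\<^sup>2 \<noteq> (0::real)" "Rep_so3 M = quat_mat w1 x1 y1 z1"
    using rotation_matrix_is_quat_mat Rep_so3 by (metis mem_Collect_eq)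
  obtain w2 x2 y2 z2 where N: "w2\<^sup>2 + x2\<^sup>2 + y2\<^sup>2 + z2\<^sup>2 \<noteq> (0::real)" "Rep_so3 N = quat_mat w2 x2 y2 z2"
    using rotation_matrix_is_quat_mat Rep_so3 by (metis mem_Collect_eq)
  define w x y z where wxyz: "w = [:w1, w2 - w1:]" "x = [:x1, x2 - x1:]"
    "y = [:y1, y2 - y1:]" "z = [:z1, z2 - z1:]"
  define n where "n = w\<^sup>2 + x\<^sup>2 + y\<^sup>2 + z\<^sup>2"
  define c where "c t = Abs_so3 (quat_mat (poly w t) (poly x t) (poly y t) (poly z t))" for t
  have c: "Rep_so3 (c t) = quat_mat (poly w t) (poly x t) (poly y t) (poly z t)"
    if "poly n t \<noteq> 0" for t
    unfolding c_def using that by (intro Abs_so3_inverse) (simp add: rotation_matrix_quat_mat n_def)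
  have c0: "c 0 = M" unfolding c_def wxyz using M(2) by (simp add: Rep_so3_inverse flip: M(2))
  have c1: "c 1 = N" unfolding c_def wxyz using N(2) by (simp add: Rep_so3_inverse flip: N(2))
  have n0: "poly n 0 \<noteq> 0" using M(1) by (simp add: n_def wxyz)
  have n1: "poly n 1 \<noteq> 0" using N(1) by (simp add: n_def wxyz)
  have clear: "\<exists>p m. \<forall>t. poly n t \<noteq> 0 \<longrightarrow> poly p t = poly n t ^ m * h (c t)"
    if "h \<in> poly_funs UNIV so3_entries" for h
    using that
  proof (induction rule: poly_funs.induct)
    case (const a)
    show ?case by (rule exI[of _ "[:a:]"], rule exI[of _ 0]) simp
  next
    case (coord \<xi>)
    then obtain i j where \<xi>: "\<xi> = (\<lambda>M. Rep_so3 M $ i $ j)" by (auto simp: so3_entries_def)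
    define E :: "real poly^3^3" where "E =
     vector [vector [w\<^sup>2 + x\<^sup>2 - y\<^sup>2 - z\<^sup>2, 2 * (x * y - w * z), 2 * (x * z + w * y)],
             vector [2 * (x * y + w * z), w\<^sup>2 - x\<^sup>2 + y\<^sup>2 - z\<^sup>2, 2 * (y * z - w * x)],
             vector [2 * (x * z - w * y), 2 * (y * z + w * x), w\<^sup>2 - x\<^sup>2 - y\<^sup>2 + z\<^sup>2]]"
    have "poly (E $ i $ j) t = poly n t ^ 1 * \<xi> (c t)" if "poly n t \<noteq> 0" for t
    proof -
      have nt: "poly n t = (poly w t)\<^sup>2 + (poly x t)\<^sup>2 + (poly y t)\<^sup>2 + (poly z t)\<^sup>2"
        by (simp add: n_def)
      show ?thesis
        using exhaust_3[of i] exhaust_3[of j] that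
        unfolding \<xi> c[OF that] quat_mat_def Let_def nt[symmetric] E_def
        by (elim disjE) (simp_all add: vector_3)
    qed
    then show ?case by blast
  next
    case (add h1 h2)
    then obtain p1 m1 p2 m2 where
      "\<forall>t. poly n t \<noteq> 0 \<longrightarrow> poly p1 t = poly n t ^ m1 * h1 (c t)"
      "\<forall>t. poly n t \<noteq> 0 \<longrightarrow> poly p2 t = poly n t ^ m2 * h2 (c t)" by blast
    then show ?case
      by (intro exI[of _ "p1 * n ^ m2 + p2 * n ^ m1"] exI[of _ "m1 + m2"])
         (simp add: algebra_simps power_add)
  next
    case (mult h1 h2)
    then obtain p1 m1 p2 m2 where
      "\<forall>t. poly n t \<noteq> 0 \<longrightarrow> poly p1 t = poly n t ^ m1 * h1 (c t)"
      "\<forall>t. poly n t \<noteq> 0 \<longrightarrow> poly p2 t = poly n t ^ m2 * h2 (c t)" by blast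
    then show ?case
      by (intro exI[of _ "p1 * p2"] exI[of _ "m1 + m2"]) (simp add: algebra_simps power_add)
  qed
  obtain p m where p: "\<And>t. poly n t \<noteq> 0 \<Longrightarrow> poly p t = poly n t ^ m * f (c t)"
    using clear[OF f] by blast
  obtain q l where q: "\<And>t. poly n t \<noteq> 0 \<Longrightarrow> poly q t = poly n t ^ l * g (c t)"
    using clear[OF g] by blast
  have "poly p 0 \<noteq> 0" using p[OF n0] c0 fM n0 by simp
  moreover have "poly q 1 \<noteq> 0" using q[OF n1] c1 gN n1 by simp
  ultimately have "p * q * n \<noteq> 0" using n0 by auto
  then have "finite {t. poly (p * q * n) t = 0}" by (rule poly_roots_finite)
  then obtain t where t: "poly (p * q * n) t \<noteq> 0"
    using ex_new_if_finite[OF infinite_UNIV_char_0] by blast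
  then have "f (c t) * g (c t) \<noteq> 0" using p[of t] q[of t] by auto
  then show ?thesis by blast
qed

instantiation so3_ring :: idom
begin

lift_definition zero_so3_ring :: so3_ring is "\<lambda>_. 0" by (rule poly_funs.const) simp
lift_definition one_so3_ring :: so3_ring is "\<lambda>_. 1" by (rule poly_funs.const) simp
lift_definition plus_so3_ring :: "so3_ring \<Rightarrow> so3_ring \<Rightarrow> so3_ring" is "\<lambda>f g x. f x + g x"
  by (rule poly_funs.add)
lift_definition times_so3_ring :: "so3_ring \<Rightarrow> so3_ring \<Rightarrow> so3_ring" is "\<lambda>f g x. f x * g x"
  by (rule poly_funs.mult)
lift_definition uminus_so3_ring :: "so3_ring \<Rightarrow> so3_ring" is "\<lambda>f x. - f x"
  using poly_funs.mult[OF poly_funs.const[of "-1" UNIV so3_entries]] by simp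
lift_definition minus_so3_ring :: "so3_ring \<Rightarrow> so3_ring \<Rightarrow> so3_ring" is "\<lambda>f g x. f x - g x"
  using poly_funs.add[OF _ poly_funs.mult[OF poly_funs.const[of "-1" UNIV so3_entries]]] by simp

instance
proof
  fix a b :: so3_ring
  assume "a \<noteq> 0" "b \<noteq> 0"
  then show "a * b \<noteq> 0"
    by transfer (use so3_poly_funs_no_zero_divisors in \<open>metis (mono_tags)\<close>)
next
  show "(0::so3_ring) \<noteq> 1" by transfer (metis zero_neq_one)
qed (transfer; simp add: algebra_simps)+

end

lift_definition so3_const :: "real \<Rightarrow> so3_ring" is "\<lambda>c _. c" by (rule poly_funs.const) simp

lift_definition so3_entry :: "3 \<Rightarrow> 3 \<Rightarrow> so3_ring" is "\<lambda>i j M. Rep_so3 M $ i $ j"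
  by (rule poly_funs.coord) (auto simp: so3_entries_def)

type_synonym K = "so3_ring fract"

definition K_of_real :: "real \<Rightarrow> K" where
  "K_of_real c = Fract (so3_const c) 1"

definition generic_rotation :: "K^3^3" where
  "generic_rotation = (\<chi> i j. Fract (so3_entry i j) 1)"


section \<open>Zariski topology and birational maps\<close>

text \<open>
  The type \<open>'a\<close> is meant to be an algebraically closed field and \<open>k\<close> a subfield of it. Varieties
  over \<open>k\<close> are represented by their sets of geometric points; a point of projective space is a line
  through the origin. As \<open>'a\<close> is infinite, polynomials and polynomial functions are the same, and
  \<open>forms k d\<close> are the homogeneous polynomials of degree \<open>d\<close> (and zero).
\<close>

definition vec_coords :: "('a^'n \<Rightarrow> 'a) set" where
  "vec_coords = range (\<lambda>i v. v $ i)"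

definition forms :: "'a::field set \<Rightarrow> nat \<Rightarrow> ('a^'n \<Rightarrow> 'a) set" where
  "forms k d = {f \<in> poly_funs k vec_coords. \<forall>c v. f (c *s v) = c ^ d * f v}"

definition proj_space :: "('a::field^'n) set set" where
  "proj_space = {vec.span {v} | v. v \<noteq> 0}"

definition affine_closed :: "'a::field set \<Rightarrow> ('a^'n) set \<Rightarrow> bool" where
  "affine_closed k Z \<longleftrightarrow> (\<exists>F \<subseteq> poly_funs k vec_coords. Z = {x. \<forall>f\<in>F. f x = 0})"

definition proj_closed :: "'a::field set \<Rightarrow> ('a^'n) set set \<Rightarrow> bool" where
  "proj_closed k Z \<longleftrightarrow>
     (\<exists>F \<subseteq> (\<Union>d. forms k d). Z = {L \<in> proj_space. \<forall>f\<in>F. \<forall>v\<in>L. f v = 0})"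

text \<open>\<open>U\<close> is relatively open in \<open>S\<close>, with equations over \<open>k\<close>, and (geometrically) dense in \<open>S\<close>.\<close>

definition dense_open :: "('a set \<Rightarrow> 'x set \<Rightarrow> bool) \<Rightarrow> 'a set \<Rightarrow> 'x set \<Rightarrow> 'x set \<Rightarrow> bool" where
  "dense_open closed_over k U S \<longleftrightarrow>
     (\<exists>Z. closed_over k Z \<and> U = S - Z) \<and> (\<forall>Z. closed_over UNIV Z \<and> U \<subseteq> Z \<longrightarrow> S \<subseteq> Z)"

text \<open>
  Regularity over \<open>k\<close> of a map from a locally closed subset of affine space to projective space,
  and of a map in the opposite direction. The open sets on which a local representation is valid
  are those where \<open>F\<close>, respectively \<open>h\<close>, does not vanish; this is no restriction, since a
  representation may be multiplied by a polynomial.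
\<close>

definition regular_to_proj ::
    "'a::field set \<Rightarrow> ('a^'n) set \<Rightarrow> ('a^'n \<Rightarrow> ('a^'m) set) \<Rightarrow> bool" where
  "regular_to_proj k S f \<longleftrightarrow>
     (\<forall>x\<in>S. \<exists>F. (\<forall>j. (\<lambda>y. F y $ j) \<in> poly_funs k vec_coords) \<and> F x \<noteq> 0 \<and>
        (\<forall>y\<in>S. F y \<noteq> 0 \<longrightarrow> f y = vec.span {F y}))"

definition regular_to_affine ::
    "'a::field set \<Rightarrow> ('a^'m) set set \<Rightarrow> (('a^'m) set \<Rightarrow> 'a^'n) \<Rightarrow> bool" where
  "regular_to_affine k Y g \<longleftrightarrow>
     (\<forall>L\<in>Y. \<exists>d F h. (\<forall>j. (\<lambda>v. F v $ j) \<in> forms k d) \<and> h \<in> forms k d \<and> (\<forall>v \<in> L - {0}. h v \<noteq> 0) \<and>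
        (\<forall>M\<in>Y. \<forall>v \<in> M - {0}. h v \<noteq> 0 \<longrightarrow> g M = inverse (h v) *s F v))"

text \<open>
  A regular map \<open>f\<close> from the affine variety \<open>S\<close> to the projective variety \<open>Y\<close>, all defined over
  \<open>k\<close>, is a birational equivalence over \<open>k\<close> if it restricts to an isomorphism over \<open>k\<close> between
  dense open subsets.
\<close>

definition birational_equivalence ::
    "'a::field set \<Rightarrow> ('a^'n) set \<Rightarrow> ('a^'m) set set \<Rightarrow> ('a^'n \<Rightarrow> ('a^'m) set) \<Rightarrow> bool" where
  "birational_equivalence k S Y f \<longleftrightarrow>
     affine_closed k S \<and> proj_closed k Y \<and> regular_to_proj k S f \<and> f ` S \<subseteq> Y \<and>
     (\<exists>U W g. dense_open affine_closed k U S \<and> dense_open proj_closed k W Y \<and>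
        regular_to_affine k W g \<and> f ` U \<subseteq> W \<and> g ` W \<subseteq> U \<and>
        (\<forall>x\<in>U. g (f x) = x) \<and> (\<forall>L\<in>W. f (g L) = L))"


section \<open>Gough-Stewart platforms\<close>

definition cross :: "'a::comm_ring_1^3 \<Rightarrow> 'a^3 \<Rightarrow> 'a^3" where
  "cross u v = vector [u$2 * v$3 - u$3 * v$2, u$3 * v$1 - u$1 * v$3, u$1 * v$2 - u$2 * v$1]"

definition mixed :: "'a::comm_ring_1^3 \<Rightarrow> 'a^3 \<Rightarrow> 'a^3 \<Rightarrow> 'a" where
  "mixed u v w = det (vector [u, v, w])"

text \<open>A twist \<open>(\<Omega>, V)\<close> is a vector with six coordinates.\<close>

definition angular :: "'a::zero^6 \<Rightarrow> 'a^3" where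
  "angular t = vector [t$1, t$2, t$3]"

definition linear_part :: "'a::zero^6 \<Rightarrow> 'a^3" where
  "linear_part t = vector [t$4, t$5, t$6]"

definition jac :: "'a::field^3^6 \<Rightarrow> 'a^3^6 \<Rightarrow> 'a^3 \<Rightarrow> 'a^6^6" where
  "jac A C P = (\<chi> i. let u = C$i + P; m = cross (A$i) u in
     vector [u$1, u$2, u$3, m$1, m$2, m$3])"

definition singularity_surface :: "'a::field^3^6 \<Rightarrow> 'a^3^6 \<Rightarrow> ('a^3) set" where
  "singularity_surface A C = {P. det (jac A C P) = 0}"

definition reciprocal :: "'a::field^3^6 \<Rightarrow> 'a^3^6 \<Rightarrow> 'a^3 \<Rightarrow> 'a^6 \<Rightarrow> bool" where
  "reciprocal A C P t \<longleftrightarrow>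
     (\<forall>i. scalar_product (C$i + P) (linear_part t) +
          scalar_product (cross (A$i) (C$i + P)) (angular t) = 0)"

definition Rec :: "'a::field^3^6 \<Rightarrow> 'a^3^6 \<Rightarrow> 'a^3 \<Rightarrow> ('a^6) set" where
  "Rec A C P = {t. reciprocal A C P t}"

definition quadric :: "(6 \<Rightarrow> 'a::field) \<Rightarrow> (6 \<Rightarrow> 'a) \<Rightarrow> 'a^3^6 \<Rightarrow> 'a^3^6 \<Rightarrow> ('a^6) set set" where
  "quadric \<alpha> \<beta> A C = {L \<in> proj_space. \<forall>t\<in>L. let \<Omega> = angular t; V = linear_part t in
     scalar_product V (C$5 - (\<Sum>i\<in>{2,3,4}. \<alpha> i *s C$i)) +
       mixed \<Omega> (A$5) (C$5) - (\<Sum>i\<in>{2,3,4}. \<alpha> i * mixed \<Omega> (A$i) (C$i)) = 0 \<and>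
     scalar_product V (C$6 - (\<Sum>i\<in>{2,3,4}. \<beta> i *s C$i)) +
       mixed \<Omega> (A$6) (C$6) - (\<Sum>i\<in>{2,3,4}. \<beta> i * mixed \<Omega> (A$i) (C$i)) = 0 \<and>
     mixed \<Omega> (A$3) (A$4) * (scalar_product V (C$2) + mixed \<Omega> (A$2) (C$2)) +
     mixed \<Omega> (A$4) (A$2) * (scalar_product V (C$3) + mixed \<Omega> (A$3) (C$3)) +
     mixed \<Omega> (A$2) (A$3) * (scalar_product V (C$4) + mixed \<Omega> (A$4) (C$4)) = 0}"

text \<open>
  An architecture is a pair \<open>(A, b)\<close> of families of six real vectors with \<open>A$1 = b$1 = 0\<close>. A property
  holds for a generic platform if it holds on a nonempty Zariski open set of architectures.
\<close>

definition platform_coords :: "((real^3^6) \<times> (real^3^6) \<Rightarrow> real) set" where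
  "platform_coords = {\<lambda>(A, b). A $ i $ j | i j. True} \<union> {\<lambda>(A, b). b $ i $ j | i j. True}"

definition generic_platform :: "(real^3^6 \<Rightarrow> real^3^6 \<Rightarrow> bool) \<Rightarrow> bool" where
  "generic_platform P \<longleftrightarrow> (\<exists>F \<subseteq> poly_funs UNIV platform_coords.
     let U = {(A, b). A$1 = 0 \<and> b$1 = 0 \<and> (\<exists>f\<in>F. f (A, b) \<noteq> 0)}
     in U \<noteq> {} \<and> (\<forall>(A, b) \<in> U. P A b))"

definition K_vec :: "real^3 \<Rightarrow> K^3" where
  "K_vec v = (\<chi> j. K_of_real (v $ j))"

definition base_points :: "real^3^6 \<Rightarrow> K^3^6" where
  "base_points A = (\<chi> i. K_vec (A$i))"

text \<open>The vectors \<open>C\<^sub>i = R b\<^sub>i - A\<^sub>i\<close> for the generic rotation \<open>R\<close>.\<close>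

definition limb_vectors :: "real^3^6 \<Rightarrow> real^3^6 \<Rightarrow> K^3^6" where
  "limb_vectors A b = (\<chi> i. generic_rotation *v K_vec (b$i) - K_vec (A$i))"

definition extend_scalars :: "'a::field^3^6 \<Rightarrow> 'a alg_closure^3^6" where
  "extend_scalars M = (\<chi> i j. to_ac (M $ i $ j))"

end

theory Submission
  imports Defs
begin

text \<open>
  Let \<open>t = (\<Omega>, V)\<close> be reciprocal to the limbs at \<open>P\<close>. As \<open>A\<^sub>1 = b\<^sub>1 = 0\<close>, one has \<open>V \<bottom> P\<close>, and the
  conditions for \<open>i = 2, 3, 4\<close> say that \<open>P \<times> \<Omega>\<close> is the vector \<open>W\<close> with
  \<open>W \<cdot> A\<^sub>i = - (V \<cdot> C\<^sub>i + [\<Omega>, A\<^sub>i, C\<^sub>i])\<close>, which depends linearly on \<open>t\<close>. The three equations of \<open>Q\<close> say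
  that this formula also holds for \<open>i = 5, 6\<close> and that \<open>W \<bottom> \<Omega>\<close>. Hence \<open>P = (V \<times> W) / (V \<cdot> \<Omega>)\<close>, which
  inverts \<open>Rec\<close> wherever \<open>V \<cdot> \<Omega> \<noteq> 0\<close>.

  Eliminating \<open>V\<close> leaves three equations \<open>r \<cdot> \<Omega> = 0\<close>, so \<open>\<Sigma>\<close> is given by the determinant of the three
  rows \<open>r\<close>, and \<open>Rec P\<close> is a line because the three rows are never all parallel: if they were, then a
  certain quadratic polynomial in \<open>\<mu>\<close> and the resultant of two quadratic polynomials in a further
  variable, with coefficients depending on \<open>\<mu>\<close>, would have a common root.

  The open sets are dense for the following reasons. The point \<open>M = Rec 0\<close> of \<open>Q\<close> satisfies
  \<open>V \<cdot> \<Omega> \<noteq> 0\<close>, and every point of \<open>Q\<close> is joined to \<open>M\<close> by a line or by the image of a line under the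
  inverse of the projection from \<open>M\<close>. The line of multiples of \<open>C\<^sub>2\<close> meets \<open>\<Sigma>\<close> in three points, all in
  the open set, and every component of the section of \<open>\<Sigma>\<close> by a plane through this line contains one
  of them.

  All this needs only that one polynomial in the coordinates of the \<open>A\<^sub>i\<close> and \<open>C\<^sub>i\<close> does not vanish. An
  example shows that it is not zero for \<open>C\<^sub>i = b\<^sub>i - A\<^sub>i\<close>; when its value there is nonzero, so is its value
  over \<open>K\<close>, of which it is the specialisation at the identity rotation.
\<close>

section \<open>Vectors and twists\<close>

notation scalar_product (infixl "\<cdot>" 72)
notation cross (infixl "\<times>\<^sub>c" 74)

lemma scalar_product_3: "u \<cdot> v = u$1 * v$1 + u$2 * v$2 + u$3 * v$(3::3)"
  by (simp add: scalar_product_def sum_3)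

lemma cross_nth [simp]:
  "(u \<times>\<^sub>c v) $ 1 = u$2 * v$3 - u$3 * v$2"
  "(u \<times>\<^sub>c v) $ 2 = u$3 * v$1 - u$1 * v$3"
  "(u \<times>\<^sub>c v) $ 3 = u$1 * v$2 - u$2 * v$1"
  by (simp_all add: cross_def)

lemmas vec3_simps = vec_eq_iff forall_3 scalar_product_3

lemma dot_commute: "u \<cdot> v = v \<cdot> (u :: 'a::comm_ring_1^'n)"
  by (simp add: scalar_product_def mult.commute)

lemma dot_linear [simp]:
  fixes u v w :: "'a::comm_ring_1^'n"
  shows "(u + v) \<cdot> w = u \<cdot> w + v \<cdot> w" "w \<cdot> (u + v) = w \<cdot> u + w \<cdot> v"
    "(u - v) \<cdot> w = u \<cdot> w - v \<cdot> w" "w \<cdot> (u - v) = w \<cdot> u - w \<cdot> v"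
    "(- u) \<cdot> w = - (u \<cdot> w)" "w \<cdot> (- u) = - (w \<cdot> u)"
    "(c *s u) \<cdot> w = c * (u \<cdot> w)" "w \<cdot> (c *s u) = c * (w \<cdot> u)"
    "0 \<cdot> w = 0" "w \<cdot> 0 = 0"
  by (simp_all add: scalar_product_def algebra_simps sum.distrib sum_subtractf sum_negf sum_distrib_left)

lemma cross_linear [simp]:
  fixes u v w :: "'a::comm_ring_1^3"
  shows "(u + v) \<times>\<^sub>c w = u \<times>\<^sub>c w + v \<times>\<^sub>c w" "w \<times>\<^sub>c (u + v) = w \<times>\<^sub>c u + w \<times>\<^sub>c v"
    "(u - v) \<times>\<^sub>c w = u \<times>\<^sub>c w - v \<times>\<^sub>c w" "w \<times>\<^sub>c (u - v) = w \<times>\<^sub>c u - w \<times>\<^sub>c v"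
    "(- u) \<times>\<^sub>c w = - (u \<times>\<^sub>c w)" "w \<times>\<^sub>c (- u) = - (w \<times>\<^sub>c u)"
    "(c *s u) \<times>\<^sub>c w = c *s (u \<times>\<^sub>c w)" "w \<times>\<^sub>c (c *s u) = c *s (w \<times>\<^sub>c u)"
    "0 \<times>\<^sub>c w = 0" "w \<times>\<^sub>c 0 = 0" "u \<times>\<^sub>c u = 0"
  by (simp_all add: vec3_simps algebra_simps)

lemma dot_cross_same [simp]:
  fixes u v :: "'a::comm_ring_1^3"
  shows "u \<cdot> (u \<times>\<^sub>c v) = 0" "v \<cdot> (u \<times>\<^sub>c v) = 0" "(u \<times>\<^sub>c v) \<cdot> u = 0" "(u \<times>\<^sub>c v) \<cdot> v = 0"
  by (simp_all add: vec3_simps algebra_simps)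

lemma mixed_eq: "mixed u v w = u \<cdot> (v \<times>\<^sub>c w)"
  by (simp add: mixed_def det_3 scalar_product_3 algebra_simps)

lemma dot_cross_cyclic: "u \<cdot> (v \<times>\<^sub>c w) = v \<cdot> (w \<times>\<^sub>c (u :: 'a::comm_ring_1^3))"
  by (simp add: vec3_simps algebra_simps)

lemma cross_anticommute: "u \<times>\<^sub>c v = - (v \<times>\<^sub>c (u :: 'a::comm_ring_1^3))"
  by (simp add: vec3_simps algebra_simps)

lemma cross_cross_left:
  fixes u v w :: "'a::comm_ring_1^3"
  shows "(u \<times>\<^sub>c v) \<times>\<^sub>c w = (u \<cdot> w) *s v - (v \<cdot> w) *s u"
  by (simp add: vec3_simps algebra_simps)

lemma cross_cross_right:
  fixes u v w :: "'a::comm_ring_1^3"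
  shows "u \<times>\<^sub>c (v \<times>\<^sub>c w) = (u \<cdot> w) *s v - (u \<cdot> v) *s w"
  by (simp add: vec3_simps algebra_simps)

lemma basis_expansion:
  fixes u v w x :: "'a::comm_ring_1^3"
  shows "(u \<cdot> (v \<times>\<^sub>c w)) *s x = (x \<cdot> (v \<times>\<^sub>c w)) *s u + (x \<cdot> (w \<times>\<^sub>c u)) *s v + (x \<cdot> (u \<times>\<^sub>c v)) *s w"
  by (simp add: vec3_simps algebra_simps)

lemma dual_basis_expansion:
  fixes u v w x :: "'a::comm_ring_1^3"
  shows "(u \<cdot> (v \<times>\<^sub>c w)) *s x = (x \<cdot> u) *s (v \<times>\<^sub>c w) + (x \<cdot> v) *s (w \<times>\<^sub>c u) + (x \<cdot> w) *s (u \<times>\<^sub>c v)"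
  by (simp add: vec3_simps algebra_simps)

text \<open>The two orthogonality relations make the cross product of
  \<open>u \<times>\<^sub>c v\<close> and \<open>w\<close> vanish; a nonzero coordinate of
  \<open>u \<times>\<^sub>c v\<close> then yields the factor.\<close>

lemma parallel_to_cross:
  fixes u v w :: "'a::field^3"
  assumes "u \<cdot> w = 0" "v \<cdot> w = 0" "u \<times>\<^sub>c v \<noteq> 0"
  shows "\<exists>c. w = c *s (u \<times>\<^sub>c v)"
proof -
  define n where "n = u \<times>\<^sub>c v"
  have "n \<times>\<^sub>c w = 0" using assms unfolding n_def cross_cross_left by simp
  moreover obtain i where i: "n $ i \<noteq> 0" using assms(3) unfolding n_def by (metis vec_eq_iff zero_index)
  ultimately have "w = (w $ i / n $ i) *s n"
    using exhaust_3[of i] by (auto simp: vec3_simps field_simps)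
  then show ?thesis unfolding n_def by blast
qed

lemma exhaust_6: "(i::6) = 1 \<or> i = 2 \<or> i = 3 \<or> i = 4 \<or> i = 5 \<or> i = 6"
proof (induct i)
  case (of_int z)
  then have "0 \<le> z" "z < 6" by simp_all
  then have "z = 0 \<or> z = 1 \<or> z = 2 \<or> z = 3 \<or> z = 4 \<or> z = 5" by arith
  then show ?case by auto
qed

lemma forall_6: "(\<forall>i::6. P i) \<longleftrightarrow> P 1 \<and> P 2 \<and> P 3 \<and> P 4 \<and> P 5 \<and> P 6"
  by (metis exhaust_6)

lemma UNIV_6: "UNIV = {1::6, 2, 3, 4, 5, 6}"
  using exhaust_6 by auto

lemma sum_6: "sum f (UNIV :: 6 set) = f 1 + f 2 + f 3 + f 4 + f 5 + f 6"
  unfolding UNIV_6 by (simp add: ac_simps)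

lemma vector_6 [simp]:
  "(vector [a, b, c, d, e, f] :: 'a::zero^6) $ 1 = a"
  "(vector [a, b, c, d, e, f] :: 'a::zero^6) $ 2 = b"
  "(vector [a, b, c, d, e, f] :: 'a::zero^6) $ 3 = c"
  "(vector [a, b, c, d, e, f] :: 'a::zero^6) $ 4 = d"
  "(vector [a, b, c, d, e, f] :: 'a::zero^6) $ 5 = e"
  "(vector [a, b, c, d, e, f] :: 'a::zero^6) $ 6 = f"
  unfolding vector_def by simp_all

definition twist :: "'a::zero^3 \<Rightarrow> 'a^3 \<Rightarrow> 'a^6" where
  "twist \<Omega> V = vector [\<Omega>$1, \<Omega>$2, \<Omega>$3, V$1, V$2, V$3]"

lemma twist_nth [simp]:
  "twist \<Omega> V $ 1 = \<Omega> $ 1" "twist \<Omega> V $ 2 = \<Omega> $ 2" "twist \<Omega> V $ 3 = \<Omega> $ 3"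
  "twist \<Omega> V $ 4 = V $ 1" "twist \<Omega> V $ 5 = V $ 2" "twist \<Omega> V $ 6 = V $ 3"
  by (simp_all add: twist_def)

lemma angular_nth [simp]: "angular t $ 1 = t $ 1" "angular t $ 2 = t $ 2" "angular t $ 3 = t $ 3"
  by (simp_all add: angular_def)

lemma linear_part_nth [simp]:
  "linear_part t $ 1 = t $ 4" "linear_part t $ 2 = t $ 5" "linear_part t $ 3 = t $ 6"
  by (simp_all add: linear_part_def)

lemma angular_twist [simp]: "angular (twist \<Omega> V) = \<Omega>"
  and linear_part_twist [simp]: "linear_part (twist \<Omega> V) = V"
  and twist_angular_linear_part: "twist (angular t) (linear_part t) = t"
  by (simp_all add: vec_eq_iff forall_3 forall_6)

lemma angular_linear [simp]:
  fixes s t :: "'a::comm_ring_1^6"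
  shows "angular (s + t) = angular s + angular t" "angular (s - t) = angular s - angular t"
    "angular (c *s t) = c *s angular t" "angular (0::'a^6) = 0"
  by (simp_all add: vec_eq_iff forall_3)

lemma linear_part_linear [simp]:
  fixes s t :: "'a::comm_ring_1^6"
  shows "linear_part (s + t) = linear_part s + linear_part t"
    "linear_part (s - t) = linear_part s - linear_part t"
    "linear_part (c *s t) = c *s linear_part t" "linear_part (0::'a^6) = 0"
  by (simp_all add: vec_eq_iff forall_3)

lemma twist_eq_iff: "t = s \<longleftrightarrow> angular t = angular s \<and> linear_part t = linear_part s"
  by (auto simp: vec_eq_iff forall_3 forall_6)

section \<open>Elimination of the linear part\<close>

context
  fixes A C :: "'a::comm_ring_1^3^6"
begin

definition moments :: "'a^3^6" where "moments = (\<chi> i. A$i \<times>\<^sub>c C$i)"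

definition base_det :: 'a where "base_det = A$2 \<cdot> (A$3 \<times>\<^sub>c A$4)"

text \<open>
  By Cramer's rule, if \<open>A\<^sub>k\<close> is the combination of \<open>A\<^sub>2, A\<^sub>3, A\<^sub>4\<close> with coefficients \<open>\<alpha>\<^sub>i\<close>, then
  \<open>residual U k\<close> is \<open>base_det\<close> times \<open>U\<^sub>k - \<Sum>\<alpha>\<^sub>iU\<^sub>i\<close>; this form stays polynomial in \<open>A\<close>.
\<close>

definition residual :: "'a^3^6 \<Rightarrow> 6 \<Rightarrow> 'a^3" where
  "residual U k = base_det *s U$k - ((A$k \<cdot> (A$3 \<times>\<^sub>c A$4)) *s U$2
     + (A$k \<cdot> (A$4 \<times>\<^sub>c A$2)) *s U$3 + (A$k \<cdot> (A$2 \<times>\<^sub>c A$3)) *s U$4)"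

definition C_residual :: "6 \<Rightarrow> 'a^3" where "C_residual = residual C"
definition moment_residual :: "6 \<Rightarrow> 'a^3" where "moment_residual = residual moments"

definition V0 :: "'a^3" where "V0 = C_residual 5 \<times>\<^sub>c C_residual 6"
definition dual5 :: "'a^3" where "dual5 = C_residual 6 \<times>\<^sub>c C$2"
definition dual6 :: "'a^3" where "dual6 = C$2 \<times>\<^sub>c C_residual 5"
definition residual_det :: 'a where "residual_det = V0 \<cdot> C$2"

text \<open>
  The two linear equations of \<open>Q\<close> and the condition for the second limb determine
  \<open>residual_det *s V = lin P 1 \<Omega>\<close>; substituting this in the conditions for the limbs \<open>3, 4\<close> and \<open>1\<close> gives
  the equations \<open>limb_row i P 1 \<cdot> \<Omega> = 0\<close> and \<open>base_row P 1 \<cdot> \<Omega> = 0\<close>. The argument \<open>z\<close> makes these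
  expressions homogeneous in \<open>(P, z)\<close>.
\<close>

definition row_slope :: "6 \<Rightarrow> 'a^3" where
  "row_slope i = residual_det *s A$i - (V0 \<cdot> C$i) *s A$2"
definition row_offset :: "6 \<Rightarrow> 'a^3" where
  "row_offset i = residual_det *s moments$i - (V0 \<cdot> C$i) *s moments$2
     - (C$i \<cdot> dual5) *s moment_residual 5 - (C$i \<cdot> dual6) *s moment_residual 6"

definition limb_row :: "6 \<Rightarrow> 'a^3 \<Rightarrow> 'a \<Rightarrow> 'a^3" where
  "limb_row i P z = row_slope i \<times>\<^sub>c P + z *s row_offset i"
definition base_row :: "'a^3 \<Rightarrow> 'a \<Rightarrow> 'a^3" where
  "base_row P z = (z * (P \<cdot> dual5)) *s moment_residual 5 + (z * (P \<cdot> dual6)) *s moment_residual 6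
     + (P \<cdot> V0) *s (z *s moments$2 + A$2 \<times>\<^sub>c P)"
definition lin :: "'a^3 \<Rightarrow> 'a \<Rightarrow> 'a^3 \<Rightarrow> 'a^3" where
  "lin P z \<Omega> = - ((z * (\<Omega> \<cdot> moment_residual 5)) *s dual5 + (z * (\<Omega> \<cdot> moment_residual 6)) *s dual6
     + (\<Omega> \<cdot> (z *s moments$2 + A$2 \<times>\<^sub>c P)) *s V0)"

text \<open>The reciprocity condition of limb \<open>i\<close> without the term
  \<open>P \<cdot> V\<close>, which is common to all limbs and is the whole condition of the first
  one.\<close>

definition limb :: "'a^3 \<Rightarrow> 'a^6 \<Rightarrow> 6 \<Rightarrow> 'a" where
  "limb P t i = C$i \<cdot> linear_part t + (moments$i + A$i \<times>\<^sub>c P) \<cdot> angular t"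

definition residual_form :: "6 \<Rightarrow> 'a^6 \<Rightarrow> 'a" where
  "residual_form k t = C_residual k \<cdot> linear_part t + moment_residual k \<cdot> angular t"

text \<open>By Cramer's rule \<open>base_det *s A$k\<close> is a combination of \<open>A$2\<close>,
  \<open>A$3\<close>, \<open>A$4\<close>, so the terms with \<open>P\<close> cancel: once limbs 2 to
  4 are satisfied, the others impose conditions free of \<open>P\<close>.\<close>

lemma limb_residual:
  "base_det * limb P t k = (A$k \<cdot> (A$3 \<times>\<^sub>c A$4)) * limb P t 2
     + (A$k \<cdot> (A$4 \<times>\<^sub>c A$2)) * limb P t 3 + (A$k \<cdot> (A$2 \<times>\<^sub>c A$3)) * limb P t 4 + residual_form k t"
proof -
  have "(base_det *s A$k) \<times>\<^sub>c P \<cdot> angular t = ((A$k \<cdot> (A$3 \<times>\<^sub>c A$4)) *s A$2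
     + (A$k \<cdot> (A$4 \<times>\<^sub>c A$2)) *s A$3 + (A$k \<cdot> (A$2 \<times>\<^sub>c A$3)) *s A$4) \<times>\<^sub>c P \<cdot> angular t"
    unfolding base_det_def by (subst basis_expansion) simp
  then show ?thesis
    by (simp add: limb_def residual_form_def C_residual_def moment_residual_def residual_def algebra_simps)
qed

text \<open>Up to the factor \<open>residual_det\<close>, the vectors \<open>dual5\<close>,
  \<open>dual6\<close>, \<open>V0\<close> are the basis dual to \<open>C_residual 5\<close>,
  \<open>C_residual 6\<close>, \<open>C$2\<close>.\<close>

lemma dot_p:
  "C_residual 5 \<cdot> dual5 = residual_det" "C_residual 6 \<cdot> dual5 = 0" "C$2 \<cdot> dual5 = 0"
  "C_residual 5 \<cdot> dual6 = 0" "C_residual 6 \<cdot> dual6 = residual_det" "C$2 \<cdot> dual6 = 0"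
  "C_residual 5 \<cdot> V0 = 0" "C_residual 6 \<cdot> V0 = 0" "C$2 \<cdot> V0 = residual_det"
  by (simp_all add: dual5_def dual6_def V0_def residual_det_def vec3_simps algebra_simps)

lemma residual_det_expansion:
  "residual_det *s V = (V \<cdot> C_residual 5) *s dual5 + (V \<cdot> C_residual 6) *s dual6 + (V \<cdot> C$2) *s V0"
  using dual_basis_expansion[of "C_residual 5" "C_residual 6" "C$2" V] dot_p(1)
  by (simp add: dual5_def dual6_def V0_def)

lemma lin_dot:
  "C_residual 5 \<cdot> lin P 1 \<Omega> = - (residual_det * (moment_residual 5 \<cdot> \<Omega>))" "C_residual 6 \<cdot> lin P 1 \<Omega> = - (residual_det * (moment_residual 6 \<cdot> \<Omega>))"
  "C$2 \<cdot> lin P 1 \<Omega> = - (residual_det * ((moments$2 + A$2 \<times>\<^sub>c P) \<cdot> \<Omega>))"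
  by (simp_all add: lin_def dot_p dot_commute[of \<Omega>] algebra_simps)

lemma limb_row_dot:
  assumes "i \<in> {3, 4}"
  shows "C$i \<cdot> lin P 1 \<Omega> + residual_det * ((moments$i + A$i \<times>\<^sub>c P) \<cdot> \<Omega>) = limb_row i P 1 \<cdot> \<Omega>"
  by (simp add: lin_def limb_row_def row_slope_def row_offset_def dot_commute[of \<Omega>] dot_commute[of _ V0] algebra_simps)

lemma base_row_dot: "P \<cdot> lin P 1 \<Omega> = - (base_row P 1 \<cdot> \<Omega>)"
  by (simp add: lin_def base_row_def dot_commute[of \<Omega>] algebra_simps)

end

lemma reciprocal_iff_limb:
  fixes A C :: "'a::field^3^6"
  assumes "A$1 = 0" "C$1 = 0"
  shows "reciprocal A C P t \<longleftrightarrow> P \<cdot> linear_part t = 0 \<and> (\<forall>i. limb A C P t i = 0)"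
proof -
  have eq: "(C$i + P) \<cdot> linear_part t + (A$i \<times>\<^sub>c (C$i + P)) \<cdot> angular t
    = P \<cdot> linear_part t + limb A C P t i" for i
    by (simp add: limb_def moments_def algebra_simps)
  have limb1: "limb A C P t 1 = 0" using assms by (simp add: limb_def moments_def)
  show ?thesis
    unfolding reciprocal_def eq
  proof safe
    assume *: "\<forall>i. P \<cdot> linear_part t + limb A C P t i = 0"
    show "P \<cdot> linear_part t = 0" using *[rule_format, of 1] limb1 by simp
    then show "limb A C P t i = 0" for i using *[rule_format, of i] by simp
  qed simp
qed

lemma reciprocal_iff:
  fixes A C :: "'a::field^3^6"
  assumes "A$1 = 0" "C$1 = 0" "base_det A \<noteq> 0"
  shows "reciprocal A C P t \<longleftrightarrow> P \<cdot> linear_part t = 0 \<and> limb A C P t 2 = 0 \<and> limb A C P t 3 = 0 \<and>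
     limb A C P t 4 = 0 \<and> residual_form A C 5 t = 0 \<and> residual_form A C 6 t = 0"
proof -
  have "limb A C P t 1 = 0" using assms by (simp add: limb_def moments_def)
  moreover have "limb A C P t k = 0 \<longleftrightarrow> residual_form A C k t = 0"
    if "limb A C P t 2 = 0" "limb A C P t 3 = 0" "limb A C P t 4 = 0" for k
  proof -
    have "base_det A * limb A C P t k = residual_form A C k t"
      by (subst limb_residual) (simp add: that)
    then show ?thesis using assms(3) by (metis mult_eq_0_iff)
  qed
  ultimately show ?thesis
    unfolding reciprocal_iff_limb[OF assms(1,2)] forall_6 by blast
qed

lemma reciprocal_iff_rows:
  fixes A C :: "'a::field^3^6"
  assumes A: "A$1 = 0" "C$1 = 0" "base_det A \<noteq> 0" and residual_det: "residual_det A C \<noteq> 0"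
  shows "reciprocal A C P t \<longleftrightarrow> residual_det A C *s linear_part t = lin A C P 1 (angular t) \<and>
     base_row A C P 1 \<cdot> angular t = 0 \<and> limb_row A C 3 P 1 \<cdot> angular t = 0 \<and> limb_row A C 4 P 1 \<cdot> angular t = 0"
proof -
  let ?V = "linear_part t" and ?\<Omega> = "angular t"
  have eq: "residual_det A C *s ?V = lin A C P 1 ?\<Omega> \<longleftrightarrow>
    residual_form A C 5 t = 0 \<and> residual_form A C 6 t = 0 \<and> limb A C P t 2 = 0" (is "?l \<longleftrightarrow> ?r")
  proof
    assume ?l
    then have Y: "residual_det A C * (Y \<cdot> ?V) = Y \<cdot> lin A C P 1 ?\<Omega>" for Y
      by (metis dot_linear(8))
    have cancel: "x + y = 0" if "residual_det A C * x = - (residual_det A C * y)" for x y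
    proof -
      have "residual_det A C * (x + y) = 0" using that by (simp add: distrib_left)
      then show ?thesis using residual_det by simp
    qed
    show ?r
      unfolding residual_form_def limb_def
      by (intro conjI cancel Y[THEN trans] lin_dot)
  next
    assume r: ?r
    then have "?V \<cdot> C_residual A C 5 = - (moment_residual A C 5 \<cdot> ?\<Omega>)" "?V \<cdot> C_residual A C 6 = - (moment_residual A C 6 \<cdot> ?\<Omega>)"
      "?V \<cdot> C$2 = - ((moments A C$2 + A$2 \<times>\<^sub>c P) \<cdot> ?\<Omega>)"
      unfolding residual_form_def limb_def eq_neg_iff_add_eq_0 by (metis dot_commute)+
    then show ?l unfolding residual_det_expansion[of A C ?V] lin_def
      by (simp only: dot_commute[of ?\<Omega>]) (simp add: vec_eq_iff)
  qed
  have limb: "limb A C P t i = 0 \<longleftrightarrow> limb_row A C i P 1 \<cdot> ?\<Omega> = 0"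
    if "residual_det A C *s ?V = lin A C P 1 ?\<Omega>" "i \<in> {3, 4}" for i
  proof -
    have "residual_det A C * limb A C P t i = limb_row A C i P 1 \<cdot> ?\<Omega>"
      unfolding limb_row_dot[OF that(2), symmetric] that(1)[symmetric] by (simp add: limb_def algebra_simps)
    then show ?thesis using residual_det by (metis mult_eq_0_iff)
  qed
  have base_row: "P \<cdot> ?V = 0 \<longleftrightarrow> base_row A C P 1 \<cdot> ?\<Omega> = 0" if "residual_det A C *s ?V = lin A C P 1 ?\<Omega>"
  proof -
    have "residual_det A C * (P \<cdot> ?V) = - (base_row A C P 1 \<cdot> ?\<Omega>)"
      unfolding base_row_dot[symmetric] that[symmetric] by simp
    then show ?thesis using residual_det by (metis mult_eq_0_iff neg_equal_0_iff_equal)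
  qed
  show ?thesis
  proof (cases "residual_det A C *s ?V = lin A C P 1 ?\<Omega>")
    case True
    have "limb A C P t 3 = 0 \<longleftrightarrow> limb_row A C 3 P 1 \<cdot> ?\<Omega> = 0" "limb A C P t 4 = 0 \<longleftrightarrow> limb_row A C 4 P 1 \<cdot> ?\<Omega> = 0"
      by (rule limb[OF True], simp)+
    then show ?thesis
      using True eq base_row[OF True] unfolding reciprocal_iff[OF A] by blast
  next
    case False
    then show ?thesis using eq unfolding reciprocal_iff[OF A] by blast
  qed
qed

section \<open>The rows are not all parallel\<close>

text \<open>
  The remainder \<open>x + y m\<close> of a polynomial modulo \<open>m\<^sup>2 + b m + c\<close>, and the norm of this remainder, that
  is, the product of its values at the two roots; unlike the roots, they are polynomial in the data.
\<close>

definition quad_reduce :: "'a::comm_ring_1 \<Rightarrow> 'a \<Rightarrow> 'a poly \<Rightarrow> 'a \<times> 'a" where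
  "quad_reduce b c p = fold_coeffs (\<lambda>a (x, y). (a - c * y, x - b * y)) p (0, 0)"

lemma quad_reduce_0 [simp]: "quad_reduce b c 0 = (0, 0)"
  by (simp add: quad_reduce_def)

lemma quad_reduce_pCons [simp]:
  "quad_reduce b c (pCons a p) = (case quad_reduce b c p of (x, y) \<Rightarrow> (a - c * y, x - b * y))"
  by (cases "a = 0 \<and> p = 0") (auto simp: quad_reduce_def)

lemma poly_quad_reduce:
  fixes b c m :: "'a::comm_ring_1"
  assumes "m\<^sup>2 + b * m + c = 0"
  shows "poly p m = fst (quad_reduce b c p) + snd (quad_reduce b c p) * m"
proof (induction p)
  case (pCons a p)
  obtain x y where xy: "quad_reduce b c p = (x, y)" by fastforce
  have "poly (pCons a p) m = a + m * (x + y * m)" using pCons xy by simp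
  also have "\<dots> = (a - c * y) + (x - b * y) * m + y * (m\<^sup>2 + b * m + c)"
    by (simp add: algebra_simps power2_eq_square)
  finally show ?case using assms xy by simp
qed simp

definition quad_norm :: "'a::comm_ring_1 \<Rightarrow> 'a \<Rightarrow> 'a poly \<Rightarrow> 'a" where
  "quad_norm b c p = (case quad_reduce b c p of (x, y) \<Rightarrow> x\<^sup>2 - b * x * y + c * y\<^sup>2)"

text \<open>By Vieta's formulas \<open>n\<close> is the other root, so \<open>p\<close> agrees with
  its remainder at both \<open>m\<close> and \<open>n\<close>.\<close>

lemma quad_norm_eq_mult:
  fixes b c m :: "'a::comm_ring_1"
  assumes m: "m\<^sup>2 + b * m + c = 0" and n: "n = - b - m"
  shows "quad_norm b c p = poly p m * poly p n"
proof -
  obtain x y where xy: "quad_reduce b c p = (x, y)" by fastforce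
  have "n\<^sup>2 + b * n + c = m\<^sup>2 + b * m + c" unfolding n by (simp add: algebra_simps power2_eq_square)
  then have n': "n\<^sup>2 + b * n + c = 0" using m by simp
  have "(x + y * m) * (x + y * n) = x\<^sup>2 - b * x * y + c * y\<^sup>2 - y\<^sup>2 * (m\<^sup>2 + b * m + c)"
    unfolding n by (simp add: algebra_simps power2_eq_square)
  then show ?thesis
    unfolding poly_quad_reduce[OF m] poly_quad_reduce[OF n'] quad_norm_def xy using m by simp
qed

text \<open>The vanishing expression is the resultant. Eliminating the leading terms and the
  constant terms in turn gives \<open>U * z + Y = 0\<close> and, for nonzero \<open>z\<close>,
  \<open>Y * z + W = 0\<close>.\<close>

lemma two_quadratics_common_root:
  fixes z :: "'a::idom"
  assumes "a * z\<^sup>2 + b * z + c = 0" "a' * z\<^sup>2 + b' * z + c' = 0"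
  shows "(a * c' - a' * c)\<^sup>2 - (a * b' - a' * b) * (b * c' - b' * c) = 0"
proof (cases "z = 0")
  case False
  define U Y W where UYW: "U = a * b' - a' * b" "Y = a * c' - a' * c" "W = b * c' - b' * c"
  have "U * z + Y = a * (a' * z\<^sup>2 + b' * z + c') - a' * (a * z\<^sup>2 + b * z + c)"
    by (simp add: UYW algebra_simps)
  then have U: "U * z + Y = 0" by (simp add: assms)
  have "(Y * z + W) * z = c' * (a * z\<^sup>2 + b * z + c) - c * (a' * z\<^sup>2 + b' * z + c')"
    by (simp add: UYW algebra_simps power2_eq_square)
  then have W: "Y * z + W = 0" using False by (simp add: assms)
  have "Y\<^sup>2 - U * W = Y * (U * z + Y) - U * (Y * z + W)"
    by (simp add: algebra_simps power2_eq_square)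
  then show ?thesis using U W by (simp add: UYW)
qed (use assms in auto)

definition vmap :: "('a \<Rightarrow> 'b) \<Rightarrow> 'a^'n \<Rightarrow> 'b^'n" where "vmap f v = (\<chi> i. f (v $ i))"

lemma vmap_nth [simp]: "vmap f v $ i = f (v $ i)" by (simp add: vmap_def)

context
  fixes A C :: "'a::comm_ring_1^3^6"
begin

text \<open>Coefficients of the quadratic for \<mu>. If \<open>L\<close> and \<open>S\<close> are
  the same combination of the slopes and of the offsets, and this combination of the rows vanishes,
  then \<open>L \<times>\<^sub>c P + S = 0\<close>, whence \<open>L \<cdot> S = 0\<close>.\<close>

definition parallel_a :: 'a where "parallel_a = row_slope A C 3 \<cdot> row_offset A C 3"
definition parallel_b :: 'a where "parallel_b = row_slope A C 3 \<cdot> row_offset A C 4 + row_slope A C 4 \<cdot> row_offset A C 3"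
definition parallel_c :: 'a where "parallel_c = row_slope A C 4 \<cdot> row_offset A C 4"
definition elim_scale :: 'a where "elim_scale = parallel_a * residual_det A C * base_det A"
definition elim_dir :: "'a \<Rightarrow> 'a^3" where "elim_dir \<mu> = \<mu> *s row_slope A C 3 + parallel_a *s row_slope A C 4"
definition elim_base :: "'a \<Rightarrow> 'a^3" where
  "elim_base \<mu> = (A$2 \<times>\<^sub>c A$3) \<times>\<^sub>c (\<mu> *s row_offset A C 3 + parallel_a *s row_offset A C 4)"
definition elim_pair :: "'a^3 \<Rightarrow> 'a^3 \<Rightarrow> 'a" where
  "elim_pair U Y = elim_scale * ((U \<cdot> dual5 A C) * (moment_residual A C 5 \<cdot> Y) + (U \<cdot> dual6 A C) * (moment_residual A C 6 \<cdot> Y))"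
definition elim_moment :: "'a \<Rightarrow> 'a^3 \<Rightarrow> 'a" where
  "elim_moment \<mu> Y = elim_scale * (moments A C$2 \<cdot> Y) + (A$2 \<times>\<^sub>c elim_base \<mu>) \<cdot> Y"
definition elim_row :: "'a \<Rightarrow> 'a^3 \<Rightarrow> 'a" where
  "elim_row \<mu> Y = elim_scale * (row_offset A C 3 \<cdot> Y) + (row_slope A C 3 \<times>\<^sub>c elim_base \<mu>) \<cdot> Y"
text \<open>
  If the rows of limbs \<open>3\<close> and \<open>4\<close> at \<open>P\<close> are parallel, say \<open>\<mu> r\<^sub>3 + parallel_a r\<^sub>4 = 0\<close>, then
  \<open>elim_scale *s P = z *s L + T\<close> for some \<open>z\<close>. As \<open>r\<^sub>1\<close> is parallel to \<open>r\<^sub>3\<close>, so are the pairs of their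
  products with \<open>A\<^sub>2, L\<close> and with \<open>M, L\<close>, where \<open>M = row_slope 3\<close>; these are two quadratic equations
  in \<open>z\<close>, because \<open>r\<^sub>1 \<cdot> L\<close> and \<open>r\<^sub>1 \<cdot> A\<^sub>2\<close> are linear in \<open>z\<close> and \<open>r\<^sub>3 \<cdot> L = \<kappa>\<close> does not involve it.
\<close>

definition elim_res :: "'a \<Rightarrow> 'a" where
  "elim_res \<mu> = (let L = elim_dir \<mu>; T = elim_base \<mu>; M = row_slope A C 3; \<kappa> = elim_row \<mu> L;
      s1 = (M \<times>\<^sub>c L) \<cdot> A$2; s0 = elim_row \<mu> (A$2);
      y1 = elim_pair L L + (L \<cdot> V0 A C) * elim_moment \<mu> L; y0 = elim_pair T L + (T \<cdot> V0 A C) * elim_moment \<mu> L;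
      k0 = elim_moment \<mu> M; k1 = (A$2 \<times>\<^sub>c L) \<cdot> M;
      a = - y1 * s1; b = elim_pair L (A$2) * \<kappa> - y1 * s0 - y0 * s1; c = elim_pair T (A$2) * \<kappa> - y0 * s0;
      a' = (L \<cdot> V0 A C) * k1 * \<kappa>;
      b' = (elim_pair L M + (L \<cdot> V0 A C) * k0 + (T \<cdot> V0 A C) * k1) * \<kappa> - y1 * (elim_scale * parallel_a);
      c' = (elim_pair T M + (T \<cdot> V0 A C) * k0) * \<kappa> - y0 * (elim_scale * parallel_a)
    in (a * c' - a' * c)\<^sup>2 - (a * b' - a' * b) * (b * c' - b' * c))"

end

lemma dot_cross_dot_cross:
  fixes u v x y :: "'a::comm_ring_1^3"
  shows "(u \<times>\<^sub>c v) \<cdot> (x \<times>\<^sub>c y) = (u \<cdot> x) * (v \<cdot> y) - (u \<cdot> y) * (v \<cdot> x)"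
  by (simp add: vec3_simps algebra_simps)

lemma parallel_rows_elim:
  fixes A C :: "'a::field^3^6" and P :: "'a^3"
  assumes nz: "parallel_a A C \<noteq> 0"
    and par: "limb_row A C 3 P 1 \<times>\<^sub>c limb_row A C 4 P 1 = 0" "base_row A C P 1 \<times>\<^sub>c limb_row A C 3 P 1 = 0"
  shows "\<exists>\<mu>. \<mu>\<^sup>2 + parallel_b A C * \<mu> + parallel_a A C * parallel_c A C = 0 \<and> elim_res A C \<mu> = 0"
proof -
  define r1 r3 r4 M3 M4 S3 S4 a N \<eta> where
    rows: "r1 = base_row A C P 1" "r3 = limb_row A C 3 P 1" "r4 = limb_row A C 4 P 1" and
    MS: "M3 = row_slope A C 3" "M4 = row_slope A C 4" "S3 = row_offset A C 3" "S4 = row_offset A C 4" and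
    a: "a = parallel_a A C" and N: "N = A$2 \<times>\<^sub>c A$3" and \<eta>: "\<eta> = elim_scale A C"
  \<comment> \<open>As \<open>M3 \<cdot> r3 = a\<close>, expanding
    \<open>M3 \<times>\<^sub>c (r3 \<times>\<^sub>c r4) = 0\<close> gives
    \<open>\<mu> *s r3 + a *s r4 = 0\<close> for this value.\<close>
  define \<mu> where "\<mu> = - (M3 \<cdot> r4)"
  define L T Sg where "L = elim_dir A C \<mu>" "T = elim_base A C \<mu>" and Sg: "Sg = \<mu> *s S3 + a *s S4"
  have L: "L = \<mu> *s M3 + a *s M4" and T: "T = N \<times>\<^sub>c Sg"
    by (simp_all add: \<open>L = _\<close> \<open>T = _\<close> elim_dir_def elim_base_def Sg MS a N)
  have r3: "r3 = M3 \<times>\<^sub>c P + S3" and r4: "r4 = M4 \<times>\<^sub>c P + S4"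
    by (simp_all add: rows MS limb_row_def)
  have aM: "M3 \<cdot> r3 = a" "M3 \<cdot> S3 = a" by (simp_all add: r3 a parallel_a_def MS)
  have "M3 \<times>\<^sub>c (r3 \<times>\<^sub>c r4) = 0" using par rows by simp
  then have "\<mu> *s r3 + a *s r4 = 0"
    unfolding cross_cross_right aM \<mu>_def by (simp add: vec_eq_iff)
  moreover have "\<mu> *s r3 + a *s r4 = L \<times>\<^sub>c P + Sg"
    by (simp add: r3 r4 L Sg vec_eq_iff algebra_simps)
  ultimately have LP: "L \<times>\<^sub>c P + Sg = 0" by simp
  \<comment> \<open>The product with \<open>L\<close> removes \<open>P\<close> and leaves
    \<open>a\<close> times the quadratic in \<mu>.\<close>
  have "L \<cdot> (L \<times>\<^sub>c P + Sg) = L \<cdot> Sg" by simp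
  also have "\<dots> = a * (\<mu>\<^sup>2 + parallel_b A C * \<mu> + a * parallel_c A C)"
    using aM(2) by (simp add: L Sg parallel_b_def parallel_c_def MS algebra_simps power2_eq_square)
  finally have \<mu>: "\<mu>\<^sup>2 + parallel_b A C * \<mu> + a * parallel_c A C = 0" using LP nz a by simp
  \<comment> \<open>\<open>N\<close> is chosen orthogonal to \<open>M3\<close>, so that
    \<open>N \<cdot> L\<close> does not depend on \<mu>. Taking the cross product with
    \<open>N\<close> then recovers \<open>P\<close> from the single parameter
    \<open>z = N \<cdot> P\<close>.\<close>
  have NM: "N \<cdot> M3 = 0" "N \<cdot> M4 = residual_det A C * base_det A"
    by (simp_all add: N MS row_slope_def base_det_def vec3_simps algebra_simps)
  have NL: "N \<cdot> L = \<eta>" by (simp add: L NM \<eta> elim_scale_def a)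
  define z where "z = N \<cdot> P"
  have "N \<times>\<^sub>c (L \<times>\<^sub>c P + Sg) = 0" using LP by simp
  then have P: "\<eta> *s P = z *s L + T"
    unfolding cross_linear cross_cross_right NL T z_def
    by (simp add: vec_eq_iff algebra_simps)
  \<comment> \<open>The homogeneous versions of the rows, of degrees 2 and 1, allow the use of
    \<open>\<eta> *s P\<close> without dividing by \<eta>.\<close>
  define r1h r3h where h: "r1h = base_row A C (\<eta> *s P) \<eta>" "r3h = limb_row A C 3 (\<eta> *s P) \<eta>"
  have "r1h = (\<eta> * \<eta>) *s r1" "r3h = \<eta> *s r3"
    by (simp_all add: h rows base_row_def limb_row_def vec_eq_iff algebra_simps)
  then have "r1h \<times>\<^sub>c r3h = 0" using par rows by simp
  then have par': "(r1h \<cdot> U) * (r3h \<cdot> Y) = (r1h \<cdot> Y) * (r3h \<cdot> U)" for U Y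
    using dot_cross_dot_cross[of r1h r3h U Y] by simp
  have r1h: "r1h \<cdot> Y = elim_pair A C L Y * z + elim_pair A C T Y
      + ((L \<cdot> V0 A C) * z + T \<cdot> V0 A C) * (elim_moment A C \<mu> Y + ((A$2 \<times>\<^sub>c L) \<cdot> Y) * z)" for Y
    unfolding h P base_row_def by (simp add: elim_pair_def elim_moment_def \<open>T = elim_base A C \<mu>\<close> \<eta> algebra_simps)
  have r3h: "r3h \<cdot> Y = elim_row A C \<mu> Y + ((M3 \<times>\<^sub>c L) \<cdot> Y) * z" for Y
    unfolding h P limb_row_def by (simp add: elim_row_def \<open>T = elim_base A C \<mu>\<close> \<eta> MS algebra_simps)
  \<comment> \<open>This removes the quadratic term from \<open>r1h \<cdot> A$2\<close>, so that the
    first relation below has degree 2 in \<open>z\<close> and not 3.\<close>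
  have [simp]: "elim_moment A C \<mu> (A$2) = 0"
    by (simp add: elim_moment_def moments_def)
  have r3M: "r3h \<cdot> M3 = \<eta> * a" by (simp add: \<open>r3h = \<eta> *s r3\<close> dot_commute[of r3] aM)
  define \<kappa> s1 s0 y1 y0 k0 k1 where
    "\<kappa> = elim_row A C \<mu> L" "s1 = (M3 \<times>\<^sub>c L) \<cdot> A$2" "s0 = elim_row A C \<mu> (A$2)"
    "y1 = elim_pair A C L L + (L \<cdot> V0 A C) * elim_moment A C \<mu> L" "y0 = elim_pair A C T L + (T \<cdot> V0 A C) * elim_moment A C \<mu> L"
    "k0 = elim_moment A C \<mu> M3" "k1 = (A$2 \<times>\<^sub>c L) \<cdot> M3"
  note defs = this
  have "r1h \<cdot> L = y1 * z + y0" "r3h \<cdot> L = \<kappa>" "r3h \<cdot> A$2 = s1 * z + s0"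
    "r1h \<cdot> A$2 = elim_pair A C L (A$2) * z + elim_pair A C T (A$2)"
    by (simp_all add: r1h r3h defs algebra_simps)
  note E = this
  have "(- y1 * s1) * z\<^sup>2 + (elim_pair A C L (A$2) * \<kappa> - y1 * s0 - y0 * s1) * z + (elim_pair A C T (A$2) * \<kappa> - y0 * s0) = 0"
    using par'[of "A$2" L] unfolding E by (simp add: algebra_simps power2_eq_square)
  moreover have "((L \<cdot> V0 A C) * k1 * \<kappa>) * z\<^sup>2
    + ((elim_pair A C L M3 + (L \<cdot> V0 A C) * k0 + (T \<cdot> V0 A C) * k1) * \<kappa> - y1 * (\<eta> * a)) * z
    + ((elim_pair A C T M3 + (T \<cdot> V0 A C) * k0) * \<kappa> - y0 * (\<eta> * a)) = 0"
    using par'[of M3 L] unfolding E r3M r1h[of M3] by (simp add: defs algebra_simps power2_eq_square)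
  ultimately have "elim_res A C \<mu> = 0"
    using two_quadratics_common_root
    unfolding elim_res_def Let_def MS[symmetric] a[symmetric] \<eta>[symmetric]
      \<open>L = elim_dir A C \<mu>\<close>[symmetric] \<open>T = elim_base A C \<mu>\<close>[symmetric] defs[symmetric]
    by blast
  then show ?thesis using \<mu> a by blast
qed

section \<open>The genericity polynomial\<close>

definition mmap :: "('a \<Rightarrow> 'b) \<Rightarrow> 'a^'n^'m \<Rightarrow> 'b^'n^'m" where "mmap f M = (\<chi> i. vmap f (M $ i))"

lemma mmap_nth [simp]: "mmap f M $ i = vmap f (M $ i)" by (simp add: mmap_def)

context
  fixes A C :: "'a::comm_ring_1^3^6"
begin

text \<open>At \<open>z = 1\<close>, up to the factor \<open>residual_det\<close>, the product
  \<open>V \<cdot> \<Omega>\<close> for the reciprocal twist built from limb rows 3 and 4.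
  Homogeneity in \<open>(P, z)\<close> gives access to points with a denominator.\<close>

definition pitch :: "'a^3 \<Rightarrow> 'a \<Rightarrow> 'a" where
  "pitch P z = (let \<Omega> = limb_row A C 3 P z \<times>\<^sub>c limb_row A C 4 P z in \<Omega> \<cdot> lin A C P z \<Omega>)"

text \<open>The cubic is \<open>residual_det * v (v + 1) (line_lead * v + line_const)\<close> at the point \<open>v *s C\<^sub>2\<close>.\<close>

definition line_lead :: 'a where
  "line_lead = moments A C$2 \<cdot> ((row_slope A C 3 \<times>\<^sub>c C$2) \<times>\<^sub>c row_offset A C 4 + row_offset A C 3 \<times>\<^sub>c (row_slope A C 4 \<times>\<^sub>c C$2))"
definition line_const :: 'a where
  "line_const = moments A C$2 \<cdot> (row_offset A C 3 \<times>\<^sub>c row_offset A C 4)"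

text \<open>The vector \<open>base_det *s W\<close>, where \<open>W \<cdot> A\<^sub>i = - (V \<cdot> C\<^sub>i + [\<Omega>, A\<^sub>i, C\<^sub>i])\<close> for \<open>i = 2, 3, 4\<close>.\<close>

definition velocity :: "'a^3 \<Rightarrow> 'a^3 \<Rightarrow> 'a^3" where
  "velocity \<Omega> V = - ((C$2 \<cdot> V + moments A C$2 \<cdot> \<Omega>) *s (A$3 \<times>\<^sub>c A$4)
     + (C$3 \<cdot> V + moments A C$3 \<cdot> \<Omega>) *s (A$4 \<times>\<^sub>c A$2)
     + (C$4 \<cdot> V + moments A C$4 \<cdot> \<Omega>) *s (A$2 \<times>\<^sub>c A$3))"

text \<open>
  A twist in the span of \<open>Q\<close> that is orthogonal to \<open>Rec 0\<close> for the quadratic form of \<open>Q\<close>, combined from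
  \<open>(0, V0)\<close> and the twist with angular part \<open>residual_det *s A\<^sub>2\<close> whose linear part is orthogonal to \<open>C\<^sub>2\<close>.
\<close>

definition tangent_angular :: "'a^3" where
  "tangent_angular = ((row_offset A C 3 \<times>\<^sub>c row_offset A C 4) \<cdot> velocity 0 (V0 A C) * residual_det A C) *s A$2"
definition tangent_linear :: "'a^3" where
  "tangent_linear = (let \<Omega> = row_offset A C 3 \<times>\<^sub>c row_offset A C 4;
      V = - ((A$2 \<cdot> moment_residual A C 5) *s dual5 A C + (A$2 \<cdot> moment_residual A C 6) *s dual6 A C)
    in (\<Omega> \<cdot> velocity 0 (V0 A C)) *s V - (\<Omega> \<cdot> velocity (residual_det A C *s A$2) V) *s V0 A C)"

text \<open>\<open>elim_res\<close> at an indeterminate: the roots \<mu> need not lie in the ring,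
  but the norm of this polynomial does.\<close>

definition elim_poly :: "'a poly" where
  "elim_poly = elim_res (mmap (\<lambda>c. [:c:]) A) (mmap (\<lambda>c. [:c:]) C) [:0, 1:]"

text \<open>The first three factors are divided by in the eliminations; \<open>line_lead\<close>
  governs the leading coefficient of the cubic along the multiples of \<open>C$2\<close>; the
  pitches handle its three zeros there; the tangent factor provides a twist off the quadric for the
  density in \<open>Q\<close>; the norm excludes parallel rows.\<close>

definition discr :: 'a where
  "discr = base_det A * residual_det A C * parallel_a A C * line_lead
     * pitch 0 1 * pitch (- C$2) 1 * pitch (- line_const *s C$2) line_lead
     * (tangent_angular \<cdot> velocity tangent_angular tangent_linear)
     * quad_norm (parallel_b A C) (parallel_a A C * parallel_c A C) elim_poly"

end

section \<open>Compatibility of the constructions with ring homomorphisms\<close>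

locale comm_ring_map =
  fixes \<phi> :: "'a::comm_ring_1 \<Rightarrow> 'b::comm_ring_1"
  assumes hom_add [simp]: "\<phi> (x + y) = \<phi> x + \<phi> y"
    and hom_mult [simp]: "\<phi> (x * y) = \<phi> x * \<phi> y"
    and hom_1 [simp]: "\<phi> 1 = 1"
begin

lemma hom_0 [simp]: "\<phi> 0 = 0"
  by (metis add_cancel_right_right hom_add)

lemma hom_uminus [simp]: "\<phi> (- x) = - \<phi> x"
  by (metis add.right_inverse eq_neg_iff_add_eq_0 hom_0 hom_add add.commute)

lemma hom_diff [simp]: "\<phi> (x - y) = \<phi> x - \<phi> y"
  by (metis hom_add hom_uminus diff_conv_add_uminus)

lemma hom_power [simp]: "\<phi> (x ^ n) = \<phi> x ^ n"
  by (induction n) simp_all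

lemma vmap_hom [simp]:
  "vmap \<phi> (u + v) = vmap \<phi> u + vmap \<phi> v" "vmap \<phi> (u - v) = vmap \<phi> u - vmap \<phi> v"
  "vmap \<phi> (- u) = - vmap \<phi> u" "vmap \<phi> (c *s u) = \<phi> c *s vmap \<phi> u" "vmap \<phi> 0 = 0"
  by (simp_all add: vec_eq_iff)

lemma cross_hom [simp]: "vmap \<phi> (u \<times>\<^sub>c v) = vmap \<phi> u \<times>\<^sub>c vmap \<phi> v"
  by (simp add: vec3_simps)

lemma dot_hom [simp]: "\<phi> (u \<cdot> v) = vmap \<phi> u \<cdot> vmap \<phi> (v::'a^3)"
  by (simp add: scalar_product_3)

context
  fixes A C :: "'a^3^6"
begin

abbreviation (input) "A' \<equiv> mmap \<phi> A"
abbreviation (input) "C' \<equiv> mmap \<phi> C"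

lemma moments_hom [simp]: "vmap \<phi> (moments A C $ i) = moments A' C' $ i"
  by (simp add: moments_def)
lemma base_det_hom [simp]: "\<phi> (base_det A) = base_det A'"
  by (simp add: base_det_def)
lemma residual_hom: "vmap \<phi> (residual A Y k) = residual A' (mmap \<phi> Y) k"
  by (simp add: residual_def)
lemma C_residual_hom [simp]: "vmap \<phi> (C_residual A C k) = C_residual A' C' k"
  by (simp add: C_residual_def residual_hom)
lemma moment_residual_hom [simp]: "vmap \<phi> (moment_residual A C k) = moment_residual A' C' k"
  by (simp add: moment_residual_def residual_def)
lemma V0_hom [simp]: "vmap \<phi> (V0 A C) = V0 A' C'"
  by (simp add: V0_def)
lemma dual5_hom [simp]: "vmap \<phi> (dual5 A C) = dual5 A' C'"
  by (simp add: dual5_def)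
lemma dual6_hom [simp]: "vmap \<phi> (dual6 A C) = dual6 A' C'"
  by (simp add: dual6_def)
lemma residual_det_hom [simp]: "\<phi> (residual_det A C) = residual_det A' C'"
  by (simp add: residual_det_def)
lemma row_slope_hom [simp]: "vmap \<phi> (row_slope A C i) = row_slope A' C' i"
  by (simp add: row_slope_def)
lemma row_offset_hom [simp]: "vmap \<phi> (row_offset A C i) = row_offset A' C' i"
  by (simp add: row_offset_def)
lemma limb_row_hom [simp]: "vmap \<phi> (limb_row A C i P z) = limb_row A' C' i (vmap \<phi> P) (\<phi> z)"
  by (simp add: limb_row_def)
lemma lin_hom [simp]: "vmap \<phi> (lin A C P z \<Omega>) = lin A' C' (vmap \<phi> P) (\<phi> z) (vmap \<phi> \<Omega>)"
  by (simp add: lin_def)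
lemma pitch_hom [simp]: "\<phi> (pitch A C P z) = pitch A' C' (vmap \<phi> P) (\<phi> z)"
  by (simp add: pitch_def Let_def)
lemma line_lead_hom [simp]: "\<phi> (line_lead A C) = line_lead A' C'"
  by (simp add: line_lead_def)
lemma line_const_hom [simp]: "\<phi> (line_const A C) = line_const A' C'"
  by (simp add: line_const_def)
lemma velocity_hom [simp]:
  "vmap \<phi> (velocity A C \<Omega> V) = velocity A' C' (vmap \<phi> \<Omega>) (vmap \<phi> V)"
  by (simp add: velocity_def)
lemma tangent_angular_hom [simp]: "vmap \<phi> (tangent_angular A C) = tangent_angular A' C'"
  by (simp add: tangent_angular_def)
lemma tangent_linear_hom [simp]: "vmap \<phi> (tangent_linear A C) = tangent_linear A' C'"
  by (simp add: tangent_linear_def Let_def)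
lemma parallel_a_hom [simp]: "\<phi> (parallel_a A C) = parallel_a A' C'"
  by (simp add: parallel_a_def)
lemma parallel_b_hom [simp]: "\<phi> (parallel_b A C) = parallel_b A' C'"
  by (simp add: parallel_b_def)
lemma parallel_c_hom [simp]: "\<phi> (parallel_c A C) = parallel_c A' C'"
  by (simp add: parallel_c_def)
lemma elim_scale_hom [simp]: "\<phi> (elim_scale A C) = elim_scale A' C'"
  by (simp add: elim_scale_def)
lemma elim_dir_hom [simp]: "vmap \<phi> (elim_dir A C \<mu>) = elim_dir A' C' (\<phi> \<mu>)"
  by (simp add: elim_dir_def)
lemma elim_base_hom [simp]: "vmap \<phi> (elim_base A C \<mu>) = elim_base A' C' (\<phi> \<mu>)"
  by (simp add: elim_base_def)
lemma elim_pair_hom [simp]: "\<phi> (elim_pair A C U Y) = elim_pair A' C' (vmap \<phi> U) (vmap \<phi> Y)"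
  by (simp add: elim_pair_def)
lemma elim_moment_hom [simp]: "\<phi> (elim_moment A C \<mu> Y) = elim_moment A' C' (\<phi> \<mu>) (vmap \<phi> Y)"
  by (simp add: elim_moment_def)
lemma elim_row_hom [simp]: "\<phi> (elim_row A C \<mu> Y) = elim_row A' C' (\<phi> \<mu>) (vmap \<phi> Y)"
  by (simp add: elim_row_def)
lemma elim_res_hom [simp]: "\<phi> (elim_res A C \<mu>) = elim_res A' C' (\<phi> \<mu>)"
  unfolding elim_res_def Let_def by simp

end

end

lemma poly_elim_poly:
  fixes A C :: "'a::comm_ring_1^3^6"
  shows "poly (elim_poly A C) m = elim_res A C m"
proof -
  interpret comm_ring_map "\<lambda>p. poly p m" by unfold_locales simp_all
  have "mmap (\<lambda>p. poly p m) (mmap (\<lambda>c. [:c:]) B) = B" for B :: "'a^3^6"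
    by (simp add: vec_eq_iff)
  then show ?thesis by (simp add: elim_poly_def)
qed

context comm_ring_map
begin

lemma map_poly_hom: "comm_ring_map (map_poly \<phi>)"
proof
  fix p q :: "'a poly"
  show "map_poly \<phi> (p + q) = map_poly \<phi> p + map_poly \<phi> q"
    by (simp add: poly_eq_iff coeff_map_poly)
  have "\<phi> (\<Sum>i\<in>I. f i) = (\<Sum>i\<in>I. \<phi> (f i))" for f :: "nat \<Rightarrow> 'a" and I
    by (induction I rule: infinite_finite_induct) simp_all
  then show "map_poly \<phi> (p * q) = map_poly \<phi> p * map_poly \<phi> q"
    by (simp add: poly_eq_iff coeff_map_poly coeff_mult)
qed simp

lemma elim_poly_hom: "map_poly \<phi> (elim_poly A C) = elim_poly (mmap \<phi> A) (mmap \<phi> C)"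
proof -
  interpret p: comm_ring_map "map_poly \<phi>" by (rule map_poly_hom)
  have "mmap (map_poly \<phi>) (mmap (\<lambda>c. [:c:]) B) = mmap (\<lambda>c. [:c:]) (mmap \<phi> B)" for B :: "'a^3^6"
    by (simp add: vec_eq_iff map_poly_pCons)
  then show ?thesis by (simp add: elim_poly_def map_poly_pCons)
qed

lemma quad_norm_hom: "\<phi> (quad_norm b c p) = quad_norm (\<phi> b) (\<phi> c) (map_poly \<phi> p)"
proof -
  have "quad_reduce (\<phi> b) (\<phi> c) (map_poly \<phi> p) = map_prod \<phi> \<phi> (quad_reduce b c p)"
    by (induction p) (simp_all add: map_poly_pCons split: prod.split)
  then show ?thesis by (simp add: quad_norm_def split: prod.split)
qed

lemma discr_hom: "\<phi> (discr A C) = discr (mmap \<phi> A) (mmap \<phi> C)"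
  by (simp add: discr_def quad_norm_hom elim_poly_hom)

end

section \<open>A platform at which the genericity polynomial does not vanish\<close>

definition example_A :: "real^3^6" where
  "example_A = vector [0, vector [1, 0, 0], vector [0, 1, 0], vector [0, 0, 1], vector [0, 0, 1], vector [0, 1, -1]]"
definition example_C :: "real^3^6" where
  "example_C = vector [0, vector [0, -1, 0], vector [1, 1, 1], vector [0, -1, 1], vector [-1, 0, 0], vector [1, 1, -1]]"

lemma discr_example: "discr example_A example_C \<noteq> 0"
proof -
  let ?A = example_A and ?C = example_C
  have vec: "u = vector [x, y, z] \<longleftrightarrow> u $ 1 = x \<and> u $ 2 = y \<and> u $ 3 = z" for u :: "real^3" and x y z
    by (simp add: vec3_simps)
  have A [simp]: "?A$2 = vector [1, 0, 0]" "?A$3 = vector [0, 1, 0]" "?A$4 = vector [0, 0, 1]"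
      "?A$5 = vector [0, 0, 1]" "?A$6 = vector [0, 1, -1]"
    and C [simp]: "?C$2 = vector [0, -1, 0]" "?C$3 = vector [1, 1, 1]" "?C$4 = vector [0, -1, 1]"
      "?C$5 = vector [-1, 0, 0]" "?C$6 = vector [1, 1, -1]"
    by (simp_all add: example_A_def example_C_def)
  have m [simp]: "moments ?A ?C $ 2 = vector [0, 0, -1]" "moments ?A ?C $ 3 = vector [1, 0, -1]"
      "moments ?A ?C $ 4 = vector [1, 0, 0]" "moments ?A ?C $ 5 = vector [0, -1, 0]"
      "moments ?A ?C $ 6 = vector [0, -1, -1]"
    by (simp_all add: moments_def vec)
  have dA [simp]: "base_det ?A = 1" by (simp add: base_det_def scalar_product_3)
  have C_residual [simp]: "C_residual ?A ?C 5 = vector [-1, 1, -1]" "C_residual ?A ?C 6 = vector [0, -1, -1]"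
    and moment_residual [simp]: "moment_residual ?A ?C 5 = vector [-1, -1, 0]" "moment_residual ?A ?C 6 = vector [0, -1, 0]"
    by (simp_all add: C_residual_def moment_residual_def residual_def vec scalar_product_3)
  have V [simp]: "V0 ?A ?C = vector [-2, -1, 1]" "dual5 ?A ?C = vector [-1, 0, 0]" "dual6 ?A ?C = vector [1, 0, -1]"
    by (simp_all add: V0_def dual5_def dual6_def vec)
  have residual_det [simp]: "residual_det ?A ?C = 1" by (simp add: residual_det_def scalar_product_3)
  have M [simp]: "row_slope ?A ?C 3 = vector [2, 1, 0]" "row_slope ?A ?C 4 = vector [-2, 0, 1]"
    and S [simp]: "row_offset ?A ?C 3 = vector [0, -1, -3]" "row_offset ?A ?C 4 = vector [1, -1, 2]"
    by (simp_all add: row_slope_def row_offset_def vec scalar_product_3)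
  have e [simp]: "line_lead ?A ?C = -1" "line_const ?A ?C = -1"
    by (simp_all add: line_lead_def line_const_def scalar_product_3)
  have a [simp]: "parallel_a ?A ?C = -1" "parallel_b ?A ?C = -2" "parallel_c ?A ?C = 0" "elim_scale ?A ?C = -1"
    by (simp_all add: elim_scale_def parallel_a_def parallel_b_def parallel_c_def scalar_product_3)
  have pitch: "pitch ?A ?C 0 1 = -8" "pitch ?A ?C (- ?C$2) 1 = -1" "pitch ?A ?C (- line_const ?A ?C *s ?C$2) (line_lead ?A ?C) = 1"
    by (simp_all add: pitch_def Let_def limb_row_def lin_def scalar_product_3)
  have tangent: "tangent_angular ?A ?C \<cdot> velocity ?A ?C (tangent_angular ?A ?C) (tangent_linear ?A ?C) = 3"
    by (simp add: tangent_angular_def tangent_linear_def velocity_def Let_def scalar_product_3)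
  \<comment> \<open>For this platform the quadratic is \<open>\<mu>\<^sup>2 - 2 * \<mu>\<close>, so
    the norm is the product of the values at its roots 2 and 0.\<close>
  have "elim_res ?A ?C 2 \<noteq> 0"
    by (simp add: elim_res_def Let_def elim_dir_def elim_base_def elim_pair_def elim_moment_def elim_row_def scalar_product_3)
  moreover have "elim_res ?A ?C 0 \<noteq> 0"
    by (simp add: elim_res_def Let_def elim_dir_def elim_base_def elim_pair_def elim_moment_def elim_row_def scalar_product_3)
  moreover have "quad_norm (-2) 0 (elim_poly ?A ?C) = elim_res ?A ?C 2 * elim_res ?A ?C 0"
    unfolding poly_elim_poly[symmetric] by (rule quad_norm_eq_mult) simp_all
  ultimately show ?thesis
    unfolding discr_def pitch tangent by simp
qed

section \<open>Polynomial functions\<close>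

hide_const (open) Polynomials.degree Polynomials.lead_coeff up_ring.coeff

lemma poly_funs_uminus:
  assumes "-1 \<in> k" "f \<in> poly_funs k coords"
  shows "(\<lambda>x. - f x) \<in> poly_funs k coords"
  using poly_funs.mult[OF poly_funs.const[OF assms(1)] assms(2)] by simp

lemma poly_funs_diff:
  assumes "-1 \<in> k" "f \<in> poly_funs k coords" "g \<in> poly_funs k coords"
  shows "(\<lambda>x. f x - g x) \<in> poly_funs k coords"
  using poly_funs.add[OF assms(2) poly_funs_uminus[OF assms(1,3)]] by simp

definition poly_vecs :: "'a::comm_ring_1 set \<Rightarrow> ('x \<Rightarrow> 'a) set \<Rightarrow> ('x \<Rightarrow> 'a^'n) set" where
  "poly_vecs k coords = {F. \<forall>j. (\<lambda>x. F x $ j) \<in> poly_funs k coords}"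

lemma poly_vecsD: "F \<in> poly_vecs k coords \<Longrightarrow> (\<lambda>x. F x $ j) \<in> poly_funs k coords"
  by (simp add: poly_vecs_def)

lemma poly_vecs_id: "(\<lambda>x. x) \<in> poly_vecs k vec_coords"
  by (auto simp: poly_vecs_def vec_coords_def intro!: poly_funs.coord)

lemma poly_vecs_const: "(\<And>j. c $ j \<in> k) \<Longrightarrow> (\<lambda>x. c) \<in> poly_vecs k coords"
  by (auto simp: poly_vecs_def intro!: poly_funs.const)

lemma poly_vecs_add:
  "F \<in> poly_vecs k coords \<Longrightarrow> H \<in> poly_vecs k coords \<Longrightarrow> (\<lambda>x. F x + H x) \<in> poly_vecs k coords"
  by (auto simp: poly_vecs_def intro!: poly_funs.add)

lemma poly_vecs_diff:
  "-1 \<in> k \<Longrightarrow> F \<in> poly_vecs k coords \<Longrightarrow> H \<in> poly_vecs k coords \<Longrightarrow> (\<lambda>x. F x - H x) \<in> poly_vecs k coords"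
  by (auto simp: poly_vecs_def intro!: poly_funs_diff)

lemma poly_vecs_uminus:
  "-1 \<in> k \<Longrightarrow> F \<in> poly_vecs k coords \<Longrightarrow> (\<lambda>x. - F x) \<in> poly_vecs k coords"
  by (auto simp: poly_vecs_def intro!: poly_funs_uminus)

lemma poly_vecs_scale:
  "f \<in> poly_funs k coords \<Longrightarrow> F \<in> poly_vecs k coords \<Longrightarrow> (\<lambda>x. f x *s F x) \<in> poly_vecs k coords"
  by (auto simp: poly_vecs_def intro!: poly_funs.mult)

lemma poly_vecs_cross:
  "-1 \<in> k \<Longrightarrow> F \<in> poly_vecs k coords \<Longrightarrow> H \<in> poly_vecs k coords \<Longrightarrow> (\<lambda>x. F x \<times>\<^sub>c H x) \<in> poly_vecs k coords"
  unfolding poly_vecs_def forall_3 mem_Collect_eq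
  by (simp add: poly_funs_diff poly_funs.mult)

lemma poly_funs_dot:
  "F \<in> poly_vecs k coords \<Longrightarrow> H \<in> poly_vecs k coords \<Longrightarrow> (\<lambda>x. F x \<cdot> (H x :: _^3)) \<in> poly_funs k coords"
  unfolding scalar_product_3 by (intro poly_funs.add poly_funs.mult poly_vecsD)

lemma poly_vecs_angular: "F \<in> poly_vecs k coords \<Longrightarrow> (\<lambda>x. angular (F x)) \<in> poly_vecs k coords"
  by (simp add: poly_vecs_def forall_3)

lemma poly_vecs_linear_part: "F \<in> poly_vecs k coords \<Longrightarrow> (\<lambda>x. linear_part (F x)) \<in> poly_vecs k coords"
  by (simp add: poly_vecs_def forall_3)

lemma poly_vecs_twist:
  "F \<in> poly_vecs k coords \<Longrightarrow> H \<in> poly_vecs k coords \<Longrightarrow> (\<lambda>x. twist (F x) (H x)) \<in> poly_vecs k coords"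
  by (simp add: poly_vecs_def forall_6)

lemmas poly_intros = poly_funs.add poly_funs.mult poly_funs_uminus poly_funs_diff poly_vecs_id
  poly_vecs_add poly_vecs_diff poly_vecs_uminus poly_vecs_scale poly_vecs_cross poly_funs_dot
  poly_vecs_angular poly_vecs_linear_part poly_vecs_twist

lemma poly_funs_mono: "f \<in> poly_funs k coords \<Longrightarrow> k \<subseteq> l \<Longrightarrow> f \<in> poly_funs l coords"
  by (induction rule: poly_funs.induct) (auto intro: poly_funs.intros)

text \<open>Used with \<open>ev e\<close> the evaluation of polynomials at \<open>e\<close> and
  \<open>lift\<close> the embedding of constants: along a path or surface with polynomial
  coordinates, a polynomial function becomes a polynomial in the parameters.\<close>

lemma poly_funs_pullback:
  fixes f :: "'a::comm_ring_1^'n \<Rightarrow> 'a" and ev :: "'e \<Rightarrow> 'r::comm_ring_1 \<Rightarrow> 'a" and \<gamma> :: "'r^'n"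
  assumes f: "f \<in> poly_funs UNIV vec_coords"
    and hom: "\<And>e. comm_ring_map (ev e)" and lift: "\<And>e c. ev e (lift c) = c"
  shows "\<exists>p. \<forall>e. ev e p = f (vmap (ev e) \<gamma>)"
  using f
proof (induction rule: poly_funs.induct)
  case (const c)
  then show ?case using lift by blast
next
  case (coord \<xi>)
  then obtain i where "\<xi> = (\<lambda>v. v $ i)" by (auto simp: vec_coords_def)
  then show ?case by (intro exI[of _ "\<gamma> $ i"]) simp
next
  case (add f g)
  then obtain p q where "\<forall>e. ev e p = f (vmap (ev e) \<gamma>)" "\<forall>e. ev e q = g (vmap (ev e) \<gamma>)" by blast
  then show ?case by (intro exI[of _ "p + q"]) (simp add: comm_ring_map.hom_add[OF hom])
next
  case (mult f g)
  then obtain p q where "\<forall>e. ev e p = f (vmap (ev e) \<gamma>)" "\<forall>e. ev e q = g (vmap (ev e) \<gamma>)" by blast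
  then show ?case by (intro exI[of _ "p * q"]) (simp add: comm_ring_map.hom_mult[OF hom])
qed

section \<open>Polynomials in one and two variables over an algebraically closed field\<close>

lemma infinite_alg_closed: "infinite (UNIV :: 'a::alg_closed_field set)"
proof
  assume fin: "finite (UNIV :: 'a set)"
  define p where "p = (\<Prod>a\<in>(UNIV::'a set). [:- a, 1:]) + 1"
  have "degree (\<Prod>a\<in>(UNIV::'a set). [:- a, 1:]) = card (UNIV :: 'a set)"
    by (subst degree_prod_eq_sum_degree) auto
  moreover have "card (UNIV :: 'a set) > 0" using fin by (simp add: card_gt_0_iff)
  ultimately have "degree p > 0" unfolding p_def by (subst degree_add_eq_left) auto
  then obtain x where "poly p x = 0" using alg_closed_imp_poly_has_root by blast
  moreover have "poly (\<Prod>a\<in>(UNIV::'a set). [:- a, 1:]) x = 0"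
    unfolding poly_prod using fin by (auto simp: prod_zero_iff)
  ultimately show False by (simp add: p_def)
qed

lemma poly_eq_0_cofinite:
  fixes p :: "'a::alg_closed_field poly"
  assumes "finite S" "\<And>x. x \<notin> S \<Longrightarrow> poly p x = 0"
  shows "p = 0"
proof (rule ccontr)
  assume "p \<noteq> 0"
  then have "finite ({x. poly p x = 0} \<union> S)" using assms(1) poly_roots_finite by blast
  then obtain x where "x \<notin> {x. poly p x = 0} \<union> S" using ex_new_if_finite infinite_alg_closed by blast
  then show False using assms(2) by blast
qed

text \<open>\<open>c\<close> splits into at most \<open>n\<close> linear factors, and each of them
  divides one copy of \<open>g\<close>.\<close>

lemma dvd_power_if_roots:
  fixes c g :: "'a::alg_closed_field poly"
  assumes "c \<noteq> 0" "degree c \<le> n" "\<And>x. poly c x = 0 \<Longrightarrow> poly g x = 0"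
  shows "c dvd g ^ n"
  using assms
proof (induction n arbitrary: c)
  case 0
  then show ?case by (simp add: is_unit_iff_degree)
next
  case (Suc n)
  show ?case
  proof (cases "degree c = 0")
    case True
    then show ?thesis using Suc.prems(1) by (meson dvd_trans is_unit_iff_degree one_dvd)
  next
    case False
    then obtain a where a: "poly c a = 0" using alg_closed_imp_poly_has_root by blast
    then obtain c' where c': "c = [:- a, 1:] * c'" using poly_eq_0_iff_dvd by (metis dvdE)
    have "[:- a, 1:] dvd g" using Suc.prems(3)[OF a] poly_eq_0_iff_dvd by blast
    moreover have "c' dvd g ^ n"
    proof (rule Suc.IH)
      show "c' \<noteq> 0" using Suc.prems(1) c' by auto
      then show "degree c' \<le> n" using Suc.prems(2) degree_mult_eq[of "[:- a, 1:]" c'] unfolding c' by simp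
      show "poly g x = 0" if "poly c' x = 0" for x using Suc.prems(3) c' that by simp
    qed
    ultimately show ?thesis unfolding c' power_Suc by (rule mult_dvd_mono)
  qed
qed

text \<open>The outer variable is the second coordinate \<open>v\<close>; the coefficients are
  polynomials in the first coordinate \<open>u\<close>.\<close>

definition poly2 :: "'a::comm_ring_1 \<times> 'a \<Rightarrow> 'a poly poly \<Rightarrow> 'a" where
  "poly2 e p = poly (poly p [:snd e:]) (fst e)"

lemma comm_ring_map_poly2: "comm_ring_map (poly2 e)"
  by unfold_locales (simp_all add: poly2_def)

lemma poly2_map_poly: "poly (map_poly (\<lambda>a. poly a u) p) v = poly2 (u, v) p"
  by (induction p) (simp_all add: poly2_def map_poly_pCons)

text \<open>
  Here \<open>c\<close> is, up to a constant, monic in \<open>v\<close>. Hence a common factor of \<open>c\<close> and \<open>h\<close> of positive degree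
  would have a zero on the line \<open>u = 0\<close>, where \<open>c\<close> and \<open>h\<close> have no common zero; and \<open>c\<close> divides a power of
  \<open>h * p\<close> since this can be tested for each value of \<open>u\<close>.
\<close>

lemma plane_curve_density:
  fixes c h p :: "'a::{alg_closed_field, field_gcd} poly poly"
    and u v e :: "'a"
  assumes lead: "lead_coeff c = [:e:]" "e \<noteq> 0"
    and vanish: "\<And>u v. poly2 (u, v) c = 0 \<Longrightarrow> poly2 (u, v) h \<noteq> 0 \<Longrightarrow> poly2 (u, v) p = 0"
    and zero: "\<And>v. poly2 (0, v) c = 0 \<Longrightarrow> poly2 (0, v) h \<noteq> 0"
    and uv: "poly2 (u, v) c = 0"
  shows "poly2 (u, v) p = 0"
proof -
  define n where "n = degree c"
  let ?at = "\<lambda>u. map_poly (\<lambda>a. poly a u)"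
  have at: "comm_ring_map (?at u)" for u :: 'a
    by (rule comm_ring_map.map_poly_hom) (unfold_locales, simp_all)
  interpret at: comm_ring_map "?at w" for w :: 'a by (rule at)
  have c0: "c \<noteq> 0" using lead by auto
  have lead_at: "coeff (?at u c) n = e" for u
    using lead by (simp add: coeff_map_poly n_def)
  have deg_at: "degree (?at u c) = n" for u
    using lead_at[of u] lead(2) by (intro antisym) (auto simp: n_def intro: map_poly_degree_leq le_degree)
  define g where "g = (h * p) ^ n"
  define m where "m = Suc (degree g) - degree c"
  obtain q r where qr: "pseudo_divmod g c = (q, r)" by fastforce
  have div: "Polynomial.smult [:e ^ m:] g = c * q + r" and r: "r = 0 \<or> degree r < n"
    using pseudo_divmod[OF c0 qr] lead by (simp_all add: m_def n_def poly_const_pow)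
  have smult: "Polynomial.smult a f = [:a:] * f" for a :: "'a poly" and f by simp
  \<comment> \<open>At a fixed \<open>u\<close> the roots of \<open>c\<close> are roots of
    \<open>h * p\<close>, so \<open>c\<close> divides the power \<open>g\<close> and hence the
    remainder. As \<open>c\<close> keeps its degree \<open>n\<close> there, the remainder must
    vanish.\<close>
  have "?at u r = 0" for u
  proof -
    have "?at u c dvd (?at u (h * p)) ^ n"
    proof (rule dvd_power_if_roots)
      show "?at u c \<noteq> 0" using lead_at[of u] lead(2) by auto
      show "degree (?at u c) \<le> n" by (simp add: deg_at)
      show "poly (?at u (h * p)) x = 0" if "poly (?at u c) x = 0" for x
        using that vanish[of u x] by (auto simp: poly2_map_poly comm_ring_map.hom_mult[OF comm_ring_map_poly2])
    qed
    then have "?at u c dvd ?at u (Polynomial.smult [:e ^ m:] g)"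
      unfolding g_def smult at.hom_mult at.hom_power by (rule dvd_mult)
    then have dvd: "?at u c dvd ?at u r"
      unfolding div at.hom_add at.hom_mult by (simp add: dvd_add_right_iff)
    have "degree (?at u r) < degree (?at u c)" if "?at u r \<noteq> 0"
      using r that map_poly_degree_leq[of "\<lambda>a. poly a u" r] unfolding deg_at by auto
    then show ?thesis using dvd dvd_imp_degree_le by (metis leD)
  qed
  then have "poly (coeff r i) u = 0" for i u
    by (metis coeff_0 coeff_map_poly poly_0)
  then have "r = 0" using poly_eq_0_cofinite[of "{}"] by (metis empty_iff finite.emptyI leading_coeff_0_iff)
  then have "Polynomial.smult [:inverse (e ^ m):] (Polynomial.smult [:e ^ m:] g) = c * Polynomial.smult [:inverse (e ^ m):] q"
    using div by simp
  then have "g = c * Polynomial.smult [:inverse (e ^ m):] q" using lead(2) by (simp flip: one_pCons)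
  then have "c dvd g" by (rule dvdI)
  then have dvd: "c dvd h ^ n * p ^ n" by (simp add: g_def power_mult_distrib)
  define d where "d = gcd c (h ^ n)"
  obtain d' where d': "c = d * d'" unfolding d_def by (meson dvdE gcd_dvd1)
  \<comment> \<open>The leading coefficient of \<open>d\<close> divides a nonzero constant, so
    \<open>d\<close> keeps its degree when \<open>u\<close> is set to 0.\<close>
  have lead_d: "lead_coeff d * lead_coeff d' = [:e:]"
    using lead(1) unfolding d' lead_coeff_mult .
  have "[:e:] dvd 1" using lead(2) by (simp add: is_unit_const_poly_iff dvd_field_iff)
  then have ld0: "lead_coeff d dvd 1"
    using dvd_trans[OF dvdI[OF lead_d[symmetric]]] by blast
  then obtain k where "1 = lead_coeff d * k" by (rule dvdE)
  then have "1 = poly (lead_coeff d) 0 * poly k 0" by (metis poly_1 poly_mult)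
  then have ld: "poly (lead_coeff d) 0 \<noteq> 0" by auto
  have "degree d = 0"
  proof (rule ccontr)
    assume "degree d \<noteq> 0"
    moreover have "degree d \<le> degree (?at 0 d)"
      using ld by (intro le_degree) (simp add: coeff_map_poly)
    ultimately obtain w where w: "poly2 (0, w) d = 0"
      using alg_closed_imp_poly_has_root[of "?at 0 d"] by (auto simp: poly2_map_poly)
    have "poly2 (0, w) c = 0"
      using w by (simp add: d' comm_ring_map.hom_mult[OF comm_ring_map_poly2])
    moreover obtain h' where "h ^ n = d * h'" unfolding d_def by (meson dvdE gcd_dvd2)
    then have "poly2 (0, w) (h ^ n) = 0"
      using w by (simp add: comm_ring_map.hom_mult[OF comm_ring_map_poly2])
    then have "poly2 (0, w) h ^ n = 0"
      by (simp add: comm_ring_map.hom_power[OF comm_ring_map_poly2])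
    ultimately show False using zero by auto
  qed
  then obtain l where "d = [:l:]" by (rule degree_eq_zeroE)
  then have "is_unit d" using ld0 by (simp add: is_unit_const_poly_iff)
  then have "coprime c (h ^ n)" unfolding d_def is_unit_gcd .
  then have "c dvd p ^ n" using dvd coprime_dvd_mult_right_iff by blast
  then obtain s where "p ^ n = c * s" by (meson dvdE)
  then have "poly2 (u, v) (p ^ n) = poly2 (u, v) c * poly2 (u, v) s"
    using comm_ring_map.hom_mult[OF comm_ring_map_poly2] by metis
  then have "poly2 (u, v) (p ^ n) = 0" unfolding uv by (rule trans) (rule mult_zero_left)
  then have "poly2 (u, v) p ^ n = 0"
    by (simp add: comm_ring_map.hom_power[OF comm_ring_map_poly2])
  then show ?thesis by simp
qed

section \<open>The inverse map\<close>

text \<open>A square matrix is singular if and only if its kernel is nonzero. The rows of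
  \<open>jac\<close> pair with the linear part first, hence the exchange of the two halves of the
  twist.\<close>

lemma det_jac_eq_0_iff:
  fixes A C :: "'a::field^3^6"
  shows "P \<in> singularity_surface A C \<longleftrightarrow> (\<exists>t. t \<noteq> 0 \<and> reciprocal A C P t)"
proof -
  define swap :: "'a^6 \<Rightarrow> 'a^6" where "swap t = twist (linear_part t) (angular t)" for t
  have [simp]: "swap (swap t) = t" "angular (swap t) = linear_part t" "linear_part (swap t) = angular t" for t
    by (simp_all add: swap_def twist_angular_linear_part)
  have "swap 0 = 0" by (simp add: swap_def twist_eq_iff)
  then have swap0: "swap t = 0 \<longleftrightarrow> t = 0" for t by (metis \<open>\<And>t. swap (swap t) = t\<close>)
  have rec: "reciprocal A C P t \<longleftrightarrow> jac A C P *v swap t = 0" for t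
    unfolding reciprocal_def vec_eq_iff[of _ 0]
    by (simp add: jac_def Let_def matrix_vector_mult_def sum_6 scalar_product_3 swap_def add.assoc
        del: cross_linear dot_linear)
  have "P \<in> singularity_surface A C \<longleftrightarrow> \<not> invertible (jac A C P)"
    by (simp add: singularity_surface_def invertible_det_nz)
  also have "\<dots> \<longleftrightarrow> (\<exists>x. x \<noteq> 0 \<and> jac A C P *v x = 0)"
    unfolding invertible_left_inverse matrix_left_invertible_ker by blast
  also have "\<dots> \<longleftrightarrow> (\<exists>t. t \<noteq> 0 \<and> reciprocal A C P t)"
    unfolding rec by (metis \<open>\<And>t. swap (swap t) = t\<close> swap0)
  finally show ?thesis .
qed

lemma reciprocal_scale: "reciprocal A C P t \<Longrightarrow> reciprocal A C P (a *s t)"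
  by (simp add: reciprocal_def del: dot_linear(1,2) cross_linear flip: distrib_left)

text \<open>The quadratic form of the Klein quadric; it is the denominator of the inverse
  map.\<close>

definition power_of :: "'a::comm_ring_1^6 \<Rightarrow> 'a" where
  "power_of t = angular t \<cdot> linear_part t"

locale good_platform =
  fixes k :: "'a::{alg_closed_field, field_gcd} set" and A C :: "'a^3^6"
  assumes A1: "A$1 = 0" and C1: "C$1 = 0" and discr: "discr A C \<noteq> 0"
    and minus1: "-1 \<in> k" and k_A: "A $ i $ j \<in> k" and k_C: "C $ i $ j \<in> k"
begin

abbreviation "dA \<equiv> base_det A"
abbreviation "\<delta> \<equiv> residual_det A C"
abbreviation "vel t \<equiv> velocity A C (angular t) (linear_part t)"

lemma nonzero: "dA \<noteq> 0" "\<delta> \<noteq> 0" "parallel_a A C \<noteq> 0" "line_lead A C \<noteq> 0"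
  "pitch A C 0 1 \<noteq> 0" "pitch A C (- C$2) 1 \<noteq> 0" "pitch A C (- line_const A C *s C$2) (line_lead A C) \<noteq> 0"
  "tangent_angular A C \<cdot> velocity A C (tangent_angular A C) (tangent_linear A C) \<noteq> 0"
  "quad_norm (parallel_b A C) (parallel_a A C * parallel_c A C) (elim_poly A C) \<noteq> 0"
  using discr unfolding discr_def by auto

definition rows :: "'a^3 \<Rightarrow> 'a^3^3" where
  "rows P = vector [base_row A C P 1, limb_row A C 3 P 1, limb_row A C 4 P 1]"

definition normal :: "'a^3 \<Rightarrow> 3 \<Rightarrow> 3 \<Rightarrow> 'a^3" where
  "normal P i j = rows P $ i \<times>\<^sub>c rows P $ j"

text \<open>Scaling the angular part by \<open>\<delta>\<close> solves
  \<open>\<delta> *s V = lin A C P 1 \<Omega>\<close> without division, so the coordinates are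
  polynomials in \<open>P\<close>.\<close>

definition rec_twist :: "'a^3 \<Rightarrow> 3 \<Rightarrow> 3 \<Rightarrow> 'a^6" where
  "rec_twist P i j = twist (\<delta> *s normal P i j) (lin A C P 1 (normal P i j))"

definition cubic :: "'a^3 \<Rightarrow> 'a" where "cubic P = rows P $ 1 \<cdot> normal P 2 3"

lemma reciprocal_rows:
  "reciprocal A C P t \<longleftrightarrow> \<delta> *s linear_part t = lin A C P 1 (angular t) \<and> (\<forall>i. rows P $ i \<cdot> angular t = 0)"
  unfolding reciprocal_iff_rows[OF A1 C1 nonzero(1,2)] forall_3 rows_def by simp

text \<open>Otherwise the elimination yields a root \<mu> of the quadratic at which
  \<open>elim_poly\<close> vanishes, so its norm would be zero.\<close>

lemma some_normal_nonzero: "\<exists>i j. normal P i j \<noteq> 0"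
proof (rule ccontr)
  assume "\<not> ?thesis"
  then have "normal P 2 3 = 0" "normal P 1 2 = 0" by blast+
  then obtain \<mu> where \<mu>: "\<mu>\<^sup>2 + parallel_b A C * \<mu> + parallel_a A C * parallel_c A C = 0" "elim_res A C \<mu> = 0"
    using parallel_rows_elim[OF nonzero(3)] by (auto simp: normal_def rows_def)
  then have "quad_norm (parallel_b A C) (parallel_a A C * parallel_c A C) (elim_poly A C) = 0"
    using quad_norm_eq_mult[OF \<mu>(1) refl, of "elim_poly A C"] by (simp add: poly_elim_poly)
  then show False using nonzero(9) by simp
qed

lemma rows_dot_normal: "cubic P = 0 \<Longrightarrow> rows P $ l \<cdot> normal P i j = 0"
proof -
  assume c: "cubic P = 0"
  have "\<forall>l i j. rows P $ l \<cdot> normal P i j = 0"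
    using c dot_cross_cyclic[of "rows P $ 1" "rows P $ 2" "rows P $ 3"]
      dot_cross_cyclic[of "rows P $ 3" "rows P $ 1" "rows P $ 2"]
      cross_anticommute[of "rows P $ 3" "rows P $ 2"] cross_anticommute[of "rows P $ 2" "rows P $ 1"]
      cross_anticommute[of "rows P $ 3" "rows P $ 1"]
    by (simp add: forall_3 normal_def cubic_def)
  then show ?thesis by blast
qed

lemma lin_scale: "lin A C P z (c *s \<Omega>) = c *s lin A C P z \<Omega>"
  by (simp add: lin_def vec_eq_iff algebra_simps)

lemma lin_0 [simp]: "lin A C P z 0 = 0"
  by (simp add: lin_def)

lemma rec_twist_reciprocal:
  assumes "cubic P = 0" shows "reciprocal A C P (rec_twist P i j)"
  using rows_dot_normal[OF assms] by (simp add: reciprocal_rows rec_twist_def lin_scale)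

lemma rec_twist_eq_0: "normal P i j = 0 \<Longrightarrow> rec_twist P i j = 0"
  by (simp add: rec_twist_def twist_eq_iff)

lemma rec_twist_nonzero: "normal P i j \<noteq> 0 \<Longrightarrow> rec_twist P i j \<noteq> 0"
proof
  assume "normal P i j \<noteq> 0" "rec_twist P i j = 0"
  moreover from this have "\<delta> *s normal P i j = 0" by (metis angular_twist rec_twist_def angular_linear(4))
  ultimately show False using nonzero(2) by simp
qed

text \<open>If \<Omega> were zero, so would be \<open>V\<close>, by the linear formula for it. Hence
  a nonzero vector \<Omega> is orthogonal to the three rows, and their determinant vanishes.\<close>

lemma cubic_eq_0:
  assumes "reciprocal A C P t" "t \<noteq> 0" shows "cubic P = 0"
proof -
  have \<Omega>: "angular t \<noteq> 0"
  proof
    assume "angular t = 0"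
    moreover from this have "\<delta> *s linear_part t = 0"
      using assms(1) by (simp add: reciprocal_rows)
    ultimately show False using assms(2) nonzero(2) by (simp add: twist_eq_iff)
  qed
  have "cubic P *s angular t = 0"
    using assms(1) dual_basis_expansion[of "rows P $ 1" "rows P $ 2" "rows P $ 3" "angular t"]
    by (simp add: reciprocal_rows cubic_def normal_def dot_commute[of "angular t"])
  then show ?thesis using \<Omega> by simp
qed

lemma surface_iff: "P \<in> singularity_surface A C \<longleftrightarrow> cubic P = 0"
  unfolding det_jac_eq_0_iff using cubic_eq_0 rec_twist_reciprocal rec_twist_nonzero some_normal_nonzero
  by metis

text \<open>A vector orthogonal to two independent rows is a multiple of their cross product, and
  \<Omega> determines \<open>V\<close>.\<close>

lemma Rec_eq_span:
  assumes c: "cubic P = 0" and n: "normal P i j \<noteq> 0"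
  shows "Rec A C P = vec.span {rec_twist P i j}"
proof (intro Set.set_eqI iffI)
  fix t assume "t \<in> Rec A C P"
  then have t: "\<delta> *s linear_part t = lin A C P 1 (angular t)" "\<And>i. rows P $ i \<cdot> angular t = 0"
    by (auto simp: Rec_def reciprocal_rows)
  obtain a where a: "angular t = a *s normal P i j"
    using parallel_to_cross[of "rows P $ i" "angular t" "rows P $ j"] t(2) n by (auto simp: normal_def)
  have "linear_part t = inverse \<delta> *s (\<delta> *s linear_part t)" using nonzero(2) by (simp add: vector_smult_assoc)
  also have "\<dots> = (a / \<delta>) *s lin A C P 1 (normal P i j)"
    unfolding t(1) a lin_scale by (simp add: vec_eq_iff divide_inverse_commute)
  finally have "t = (a / \<delta>) *s rec_twist P i j"
    using a nonzero(2) by (simp add: twist_eq_iff rec_twist_def vec_eq_iff)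
  then show "t \<in> vec.span {rec_twist P i j}" by (auto simp: vec.span_singleton)
next
  fix t assume "t \<in> vec.span {rec_twist P i j}"
  then obtain a where "t = a *s rec_twist P i j" by (auto simp: vec.span_singleton)
  then show "t \<in> Rec A C P"
    using rec_twist_reciprocal[OF c, of i j] by (simp add: Rec_def reciprocal_scale)
qed

lemma Rec_in_proj_space: "cubic P = 0 \<Longrightarrow> Rec A C P \<in> proj_space"
  unfolding proj_space_def using some_normal_nonzero[of P] Rec_eq_span[of P] rec_twist_nonzero[of P] by blast

text \<open>The limb conditions give the products of \<open>P \<times>\<^sub>c \<Omega>\<close> with
  \<open>A$2\<close>, \<open>A$3\<close>, \<open>A$4\<close>, and thus its expansion in the dual
  basis.\<close>

lemma reciprocal_velocity:
  assumes "reciprocal A C P t"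
  shows "vel t = dA *s (P \<times>\<^sub>c angular t)"
proof -
  have l: "limb A C P t i = 0" for i
    using assms reciprocal_iff_limb[OF A1 C1] by blast
  have "(P \<times>\<^sub>c angular t) \<cdot> A$i = - (C$i \<cdot> linear_part t + moments A C$i \<cdot> angular t)" for i
  proof -
    have "(P \<times>\<^sub>c angular t) \<cdot> A$i = (A$i \<times>\<^sub>c P) \<cdot> angular t"
      by (simp add: vec3_simps algebra_simps)
    also have "\<dots> = limb A C P t i - (C$i \<cdot> linear_part t + moments A C$i \<cdot> angular t)"
      by (simp add: limb_def)
    finally show ?thesis using l[of i] by simp
  qed
  then show ?thesis
    unfolding velocity_def base_det_def dual_basis_expansion by (simp add: vec_eq_iff)
qed

definition on_quadric :: "'a^6 \<Rightarrow> bool" where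
  "on_quadric t \<longleftrightarrow> residual_form A C 5 t = 0 \<and> residual_form A C 6 t = 0 \<and> angular t \<cdot> vel t = 0"

lemma reciprocal_on_quadric: "reciprocal A C P t \<Longrightarrow> on_quadric t"
  using reciprocal_iff[OF A1 C1 nonzero(1), of P t] reciprocal_velocity[of P t] by (simp add: on_quadric_def)

definition inv_point :: "'a^6 \<Rightarrow> 'a^3" where
  "inv_point t = inverse (dA * power_of t) *s (linear_part t \<times>\<^sub>c vel t)"

text \<open>As \<open>V\<close> is orthogonal to \<open>P\<close>, the product
  \<open>V \<times>\<^sub>c (P \<times>\<^sub>c \<Omega>)\<close> equals
  \<open>(V \<cdot> \<Omega>) *s P\<close>.\<close>

lemma inv_point_unique:
  assumes "reciprocal A C P t" "power_of t \<noteq> 0"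
  shows "P = inv_point t"
proof -
  have "P \<cdot> linear_part t = 0" using assms(1) reciprocal_iff_limb[OF A1 C1] by blast
  then have "linear_part t \<times>\<^sub>c vel t = (dA * power_of t) *s P"
    unfolding reciprocal_velocity[OF assms(1)]
    by (simp add: cross_cross_right power_of_def dot_commute vec_eq_iff)
  then show ?thesis using nonzero(1) assms(2) by (simp add: inv_point_def vec_eq_iff field_simps)
qed

text \<open>As \<open>vel t\<close> is orthogonal to \<Omega>, one has \<open>(V \<times>\<^sub>c
  vel t) \<times>\<^sub>c \<Omega> = (V \<cdot> \<Omega>) *s vel t\<close>; products with
  \<open>A$2\<close>, \<open>A$3\<close>, \<open>A$4\<close> return the limb conditions.\<close>

lemma inv_point_reciprocal:
  assumes "on_quadric t" "power_of t \<noteq> 0"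
  shows "reciprocal A C (inv_point t) t"
proof -
  let ?P = "inv_point t"
  have "?P \<times>\<^sub>c angular t = inverse dA *s vel t"
    using assms nonzero(1)
    by (simp add: inv_point_def cross_cross_left on_quadric_def power_of_def dot_commute vec_eq_iff)
  moreover have "(A$i \<times>\<^sub>c ?P) \<cdot> angular t = A$i \<cdot> (?P \<times>\<^sub>c angular t)" for i
    by (simp add: vec3_simps algebra_simps)
  ultimately have *: "dA * ((A$i \<times>\<^sub>c ?P) \<cdot> angular t) = A$i \<cdot> vel t" for i
    using nonzero(1) by simp
  have "A$2 \<cdot> vel t = - (dA * (C$2 \<cdot> linear_part t + moments A C$2 \<cdot> angular t))"
    "A$3 \<cdot> vel t = - (dA * (C$3 \<cdot> linear_part t + moments A C$3 \<cdot> angular t))"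
    "A$4 \<cdot> vel t = - (dA * (C$4 \<cdot> linear_part t + moments A C$4 \<cdot> angular t))"
    using dot_cross_cyclic[of "A$2" "A$3" "A$4"] dot_cross_cyclic[of "A$4" "A$2" "A$3"]
    by (simp_all add: velocity_def base_det_def algebra_simps)
  then have "dA * limb A C ?P t 2 = 0" "dA * limb A C ?P t 3 = 0" "dA * limb A C ?P t 4 = 0"
    unfolding limb_def by (simp_all add: distrib_left *)
  then show ?thesis
    using assms(1) nonzero(1) unfolding reciprocal_iff[OF A1 C1 nonzero(1)]
    by (simp add: on_quadric_def inv_point_def dot_commute[of _ "linear_part t"] dot_cross_same)
qed

end

section \<open>Fields of definition and regularity\<close>

lemma residual_eq:
  fixes A U :: "'a::comm_ring_1^3^6"
  assumes "A$j = (\<Sum>i\<in>{2,3,4}. \<alpha> i *s A$i)"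
  shows "residual A U j = base_det A *s (U$j - (\<Sum>i\<in>{2,3,4}. \<alpha> i *s U$i))"
  using dot_cross_cyclic[of "A$2" "A$3" "A$4"] dot_cross_cyclic[of "A$4" "A$2" "A$3"]
  by (simp add: assms residual_def base_det_def vec_eq_iff algebra_simps)

lemma proj_space_eq_span:
  assumes "L \<in> proj_space" "v \<in> L" "v \<noteq> 0"
  shows "L = vec.span {v}"
proof -
  obtain w where w: "L = vec.span {w}" using assms(1) by (auto simp: proj_space_def)
  then obtain c where c: "v = c *s w" using assms(2) by (auto simp: vec.span_singleton)
  then have "c \<noteq> 0" using assms(3) by auto
  show ?thesis
    unfolding w vec.span_singleton
  proof (intro Set.set_eqI iffI)
    fix x assume "x \<in> range (\<lambda>a. a *s w)"
    then obtain a where "x = a *s w" by blast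
    then have "x = (a / c) *s v" using \<open>c \<noteq> 0\<close> by (simp add: c)
    then show "x \<in> range (\<lambda>a. a *s v)" by blast
  next
    fix x assume "x \<in> range (\<lambda>a. a *s v)"
    then show "x \<in> range (\<lambda>a. a *s w)" by (auto simp: c)
  qed
qed

lemma forms_iff: "f \<in> forms k d \<longleftrightarrow> f \<in> poly_funs k vec_coords \<and> (\<forall>c v. f (c *s v) = c ^ d * f v)"
  by (simp add: forms_def)

lemma velocity_linear [simp]:
  fixes A C :: "'a::comm_ring_1^3^6"
  shows "velocity A C (\<Omega> + \<Omega>') (V + V') = velocity A C \<Omega> V + velocity A C \<Omega>' V'"
    "velocity A C (\<Omega> - \<Omega>') (V - V') = velocity A C \<Omega> V - velocity A C \<Omega>' V'"
    "velocity A C (c *s \<Omega>) (c *s V) = c *s velocity A C \<Omega> V"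
  by (simp_all add: velocity_def vec_eq_iff algebra_simps)

lemma residual_form_linear [simp]:
  fixes A C :: "'a::comm_ring_1^3^6"
  shows "residual_form A C j (s + t) = residual_form A C j s + residual_form A C j t"
    "residual_form A C j (s - t) = residual_form A C j s - residual_form A C j t"
    "residual_form A C j (c *s t) = c * residual_form A C j t"
  by (simp_all add: residual_form_def algebra_simps)

context good_platform
begin

lemma k_A_vec: "(\<lambda>x. A$i) \<in> poly_vecs k Y" and k_C_vec: "(\<lambda>x. C$i) \<in> poly_vecs k Y"
  by (simp_all add: poly_vecs_const k_A k_C)

lemma k_1: "(\<lambda>x. 1) \<in> poly_funs k Y"
  using poly_funs_uminus[OF minus1 poly_funs.const[OF minus1]] by simp

lemma k_moments: "(\<lambda>x. moments A C$i) \<in> poly_vecs k Y"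
  unfolding moments_def by (simp add: k_A_vec k_C_vec poly_vecs_cross minus1)

lemma k_base_det: "(\<lambda>x. base_det A) \<in> poly_funs k Y"
  unfolding base_det_def by (intro poly_intros minus1 k_A_vec)

lemma k_residual:
  assumes "\<And>i. (\<lambda>x. U$i) \<in> poly_vecs k Y" shows "(\<lambda>x. residual A U i) \<in> poly_vecs k Y"
  unfolding residual_def by (intro poly_intros minus1 k_A_vec k_base_det assms)

lemma k_C_residual: "(\<lambda>x. C_residual A C i) \<in> poly_vecs k Y" and k_moment_residual: "(\<lambda>x. moment_residual A C i) \<in> poly_vecs k Y"
  unfolding C_residual_def moment_residual_def by (intro k_residual k_C_vec k_moments)+

lemma k_V0: "(\<lambda>x. V0 A C) \<in> poly_vecs k Y" and k_dual5: "(\<lambda>x. dual5 A C) \<in> poly_vecs k Y"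
    and k_dual6: "(\<lambda>x. dual6 A C) \<in> poly_vecs k Y"
  unfolding V0_def dual5_def dual6_def by (intro poly_intros minus1 k_C_residual k_C_vec)+

lemma k_residual_det: "(\<lambda>x. residual_det A C) \<in> poly_funs k Y"
  unfolding residual_det_def by (intro poly_intros k_V0 k_C_vec)

lemma k_row_slope: "(\<lambda>x. row_slope A C i) \<in> poly_vecs k Y" and k_row_offset: "(\<lambda>x. row_offset A C i) \<in> poly_vecs k Y"
  unfolding row_slope_def row_offset_def
  by (intro poly_intros minus1 k_residual_det k_A_vec k_C_vec k_V0 k_moments k_dual5 k_dual6 k_moment_residual)+

lemmas k_intros = poly_intros minus1 k_A_vec k_C_vec k_1 k_moments k_base_det k_C_residual k_moment_residual k_V0 k_dual5 k_dual6 k_residual_det k_row_slope k_row_offset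

lemma k_rows: "(\<lambda>P. rows P $ i) \<in> poly_vecs k vec_coords"
proof -
  have "\<forall>i. (\<lambda>P. rows P $ i) \<in> poly_vecs k vec_coords"
    unfolding forall_3 rows_def vector_3 base_row_def limb_row_def
    by (intro conjI k_intros)
  then show ?thesis by blast
qed

lemma k_normal: "(\<lambda>P. normal P i j) \<in> poly_vecs k vec_coords"
  unfolding normal_def by (intro k_intros k_rows)

lemma k_rec_twist: "(\<lambda>P. rec_twist P i j) \<in> poly_vecs k vec_coords"
  unfolding rec_twist_def lin_def by (intro k_intros k_normal)

lemma k_cubic: "cubic \<in> poly_funs k vec_coords"
  unfolding cubic_def[abs_def] by (intro k_intros k_normal k_rows)

lemma k_vel: "(\<lambda>t. vel t) \<in> poly_vecs k vec_coords"
  unfolding velocity_def by (intro k_intros)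

lemma forms_residual: "residual_form A C j \<in> forms k 1"
  unfolding forms_iff residual_form_def[abs_def] by (auto intro!: k_intros simp: algebra_simps)

lemma forms_vel: "(\<lambda>t. angular t \<cdot> vel t) \<in> forms k 2"
  unfolding forms_iff by (auto intro!: k_intros k_vel simp: power2_eq_square)

lemma forms_power: "power_of \<in> forms k 2"
  unfolding forms_iff power_of_def[abs_def] by (auto intro!: k_intros simp: power2_eq_square)

section \<open>The quadric, the two open sets and the regular maps\<close>

definition Q :: "('a^6) set set" where "Q = {L \<in> proj_space. \<forall>t\<in>L. on_quadric t}"

lemma quadric_eq:
  assumes \<alpha>: "A$5 = (\<Sum>i\<in>{2,3,4}. \<alpha> i *s A$i)" and \<beta>: "A$6 = (\<Sum>i\<in>{2,3,4}. \<beta> i *s A$i)"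
  shows "quadric \<alpha> \<beta> A C = Q"
proof -
  have lin: "linear_part t \<cdot> (C$j - (\<Sum>i\<in>{2,3,4}. \<gamma> i *s C$i)) + mixed (angular t) (A$j) (C$j)
      - (\<Sum>i\<in>{2,3,4}. \<gamma> i * mixed (angular t) (A$i) (C$i)) = 0 \<longleftrightarrow> residual_form A C j t = 0"
    (is "?l = 0 \<longleftrightarrow> _")
    if "A$j = (\<Sum>i\<in>{2,3,4}. \<gamma> i *s A$i)" for j \<gamma> t
  proof -
    have "residual_form A C j t = dA * ?l"
      unfolding residual_form_def C_residual_def moment_residual_def residual_eq[OF that]
      by (simp add: mixed_eq moments_def dot_commute[of "linear_part t"] dot_commute[of "angular t"] algebra_simps)
    then show ?thesis using nonzero(1) by simp
  qed
  have quad: "mixed (angular t) (A$3) (A$4) * (linear_part t \<cdot> C$2 + mixed (angular t) (A$2) (C$2)) +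
     mixed (angular t) (A$4) (A$2) * (linear_part t \<cdot> C$3 + mixed (angular t) (A$3) (C$3)) +
     mixed (angular t) (A$2) (A$3) * (linear_part t \<cdot> C$4 + mixed (angular t) (A$4) (C$4))
     = - (angular t \<cdot> vel t)" for t
    by (simp add: velocity_def mixed_eq moments_def dot_commute[of _ "linear_part t"] dot_commute[of _ "angular t"] algebra_simps)
  show ?thesis
    unfolding quadric_def Let_def lin[OF \<alpha>] lin[OF \<beta>] quad Q_def on_quadric_def by simp
qed

definition Q_open :: "('a^6) set set" where "Q_open = {L \<in> Q. \<exists>t\<in>L. power_of t \<noteq> 0}"

definition surface_open :: "('a^3) set" where
  "surface_open = {P \<in> singularity_surface A C. Rec A C P \<in> Q_open}"

text \<open>On \<open>Q_open\<close> the point exists and is unique: it is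
  \<open>inv_point v\<close> for every nonzero \<open>v\<close> in \<open>L\<close>.\<close>

definition inverse_map :: "('a^6) set \<Rightarrow> 'a^3" where "inverse_map L = (THE P. Rec A C P = L)"

lemma power_of_scale: "power_of (c *s t) = c\<^sup>2 * power_of t"
  by (simp add: power_of_def power2_eq_square)

lemma power_of_0 [simp]: "power_of 0 = 0"
  by (simp add: power_of_def)

lemma Q_open_point:
  assumes L: "L \<in> Q_open" and v: "v \<in> L" "v \<noteq> 0"
  shows "power_of v \<noteq> 0" "Rec A C (inv_point v) = L" "inverse_map L = inv_point v"
    "inv_point v \<in> singularity_surface A C"
proof -
  have L': "L \<in> proj_space" "\<forall>t\<in>L. on_quadric t" "\<exists>t\<in>L. power_of t \<noteq> 0"
    using L by (auto simp: Q_open_def Q_def)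
  have span: "L = vec.span {v}" using proj_space_eq_span[OF L'(1) v] .
  then show p: "power_of v \<noteq> 0" using L'(3) by (auto simp: vec.span_singleton power_of_scale)
  have r: "reciprocal A C (inv_point v) v" using inv_point_reciprocal L'(2) v(1) p by blast
  have c: "cubic (inv_point v) = 0" using cubic_eq_0[OF r v(2)] .
  then show "inv_point v \<in> singularity_surface A C" by (simp add: surface_iff)
  show Rec: "Rec A C (inv_point v) = L"
    using proj_space_eq_span[OF Rec_in_proj_space[OF c] _ v(2)] r span by (simp add: Rec_def)
  show "inverse_map L = inv_point v"
    unfolding inverse_map_def
  proof (rule the_equality)
    fix P assume "Rec A C P = L"
    then have "reciprocal A C P v" using v(1) by (auto simp: Rec_def)
    then show "P = inv_point v" using inv_point_unique p by blast
  qed (rule Rec)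
qed

lemma proj_space_nonzero: "L \<in> proj_space \<Longrightarrow> \<exists>v\<in>L. v \<noteq> (0 :: 'a^6)"
  unfolding proj_space_def using vec.span_base by fastforce

lemma surface_closed: "affine_closed k (singularity_surface A C)"
  unfolding affine_closed_def
  by (rule exI[of _ "{cubic}"]) (use k_cubic in \<open>auto simp: surface_iff\<close>)

lemma Q_closed: "proj_closed k Q"
  unfolding proj_closed_def
proof (intro exI[of _ "{residual_form A C 5, residual_form A C 6, \<lambda>t. angular t \<cdot> vel t}"] conjI)
  show "{residual_form A C 5, residual_form A C 6, \<lambda>t. angular t \<cdot> vel t} \<subseteq> (\<Union>d. forms k d)"
    using forms_residual forms_vel by blast
qed (auto simp: Q_def on_quadric_def)

text \<open>Near a given point \<open>Rec\<close> is represented by \<open>rec_twist\<close> for a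
  pair of rows that are independent at that point.\<close>

lemma Rec_regular: "regular_to_proj k (singularity_surface A C) (Rec A C)"
  unfolding regular_to_proj_def
proof
  fix P
  obtain i j where ij: "normal P i j \<noteq> 0" using some_normal_nonzero by blast
  have "Rec A C y = vec.span {rec_twist y i j}"
    if "y \<in> singularity_surface A C" "rec_twist y i j \<noteq> 0" for y
    using that Rec_eq_span[of y i j] rec_twist_eq_0[of y i j] surface_iff by blast
  then show "\<exists>F. (\<forall>j. (\<lambda>y. F y $ j) \<in> poly_funs k vec_coords) \<and> F P \<noteq> 0 \<and>
        (\<forall>y\<in>singularity_surface A C. F y \<noteq> 0 \<longrightarrow> Rec A C y = vec.span {F y})"
    using poly_vecsD[OF k_rec_twist] rec_twist_nonzero[OF ij] by (intro exI[of _ "\<lambda>y. rec_twist y i j"]) blast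
qed

lemma Rec_in_Q: "P \<in> singularity_surface A C \<Longrightarrow> Rec A C P \<in> Q"
  unfolding Q_def surface_iff using Rec_in_proj_space reciprocal_on_quadric by (auto simp: Rec_def)

lemma inverse_map_regular: "regular_to_affine k Q_open inverse_map"
  unfolding regular_to_affine_def
proof
  fix L assume L: "L \<in> Q_open"
  define F where "F v = linear_part v \<times>\<^sub>c vel v" for v
  define h where "h v = dA * power_of v" for v
  have "F \<in> poly_vecs k vec_coords" unfolding F_def[abs_def] by (intro k_intros k_vel)
  then have "(\<lambda>v. F v $ j) \<in> forms k 2" for j
    by (auto simp: forms_iff poly_vecsD) (simp add: F_def power2_eq_square)
  moreover have "h \<in> forms k 2"
    using forms_power unfolding forms_iff h_def[abs_def] by (auto intro!: k_intros)
  moreover have "h v \<noteq> 0" if "v \<in> L - {0}" for v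
    using that Q_open_point(1)[OF L] nonzero(1) by (auto simp: h_def)
  moreover have "inverse_map M = inverse (h v) *s F v" if "M \<in> Q_open" "v \<in> M - {0}" for M v
    using Q_open_point(3)[OF that(1), of v] that(2) by (simp add: inv_point_def h_def F_def)
  ultimately show "\<exists>d F h. (\<forall>j. (\<lambda>v. F v $ j) \<in> forms k d) \<and> h \<in> forms k d \<and> (\<forall>v \<in> L - {0}. h v \<noteq> 0) \<and>
        (\<forall>M\<in>Q_open. \<forall>v \<in> M - {0}. h v \<noteq> 0 \<longrightarrow> inverse_map M = inverse (h v) *s F v)"
    by blast
qed

lemma Q_open_open: "\<exists>Z. proj_closed k Z \<and> Q_open = Q - Z"
proof (intro exI conjI)
  show "proj_closed k {L \<in> proj_space. \<forall>f\<in>{power_of}. \<forall>v\<in>L. f v = 0}"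
    unfolding proj_closed_def using forms_power by blast
qed (auto simp: Q_open_def Q_def)

text \<open>The pair of rows representing \<open>Rec\<close> varies with the point, so the
  complement is cut out by the powers of all the twists \<open>rec_twist P i j\<close>
  together.\<close>

lemma surface_open_open: "\<exists>Z. affine_closed k Z \<and> surface_open = singularity_surface A C - Z"
proof (intro exI conjI)
  let ?F = "range (\<lambda>(i, j) P. power_of (rec_twist P i j))"
  show "affine_closed k {P. \<forall>f\<in>?F. f P = 0}"
    unfolding affine_closed_def
  proof (intro exI conjI)
    show "?F \<subseteq> poly_funs k vec_coords"
      unfolding power_of_def by (auto intro!: k_intros k_rec_twist)
  qed simp
  have "(\<exists>t\<in>Rec A C P. power_of t \<noteq> 0) \<longleftrightarrow> (\<exists>i j. power_of (rec_twist P i j) \<noteq> 0)" if c: "cubic P = 0" for P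
  proof
    assume "\<exists>t\<in>Rec A C P. power_of t \<noteq> 0"
    moreover obtain i j where "normal P i j \<noteq> 0" using some_normal_nonzero by blast
    ultimately show "\<exists>i j. power_of (rec_twist P i j) \<noteq> 0"
      using Rec_eq_span[OF c] by (auto simp: vec.span_singleton power_of_scale)
  qed (use rec_twist_reciprocal[OF c] in \<open>auto simp: Rec_def\<close>)
  then have "P \<in> surface_open \<longleftrightarrow> P \<in> singularity_surface A C \<and> (\<exists>i j. power_of (rec_twist P i j) \<noteq> 0)" for P
    unfolding surface_open_def Q_open_def surface_iff using Rec_in_Q[of P] surface_iff by blast
  moreover have "P \<in> {P. \<forall>f\<in>?F. f P = 0} \<longleftrightarrow> (\<forall>i j. power_of (rec_twist P i j) = 0)" for P
    by simp
  ultimately show "surface_open = singularity_surface A C - {P. \<forall>f\<in>?F. f P = 0}"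
    by (intro Set.set_eqI) (simp only: Diff_iff, metis)
qed

end

section \<open>Density\<close>

text \<open>Along the path \<open>f\<close> is a polynomial in the parameter, and it vanishes
  outside the finitely many roots of \<open>h\<close>.\<close>

lemma poly_path_vanishing:
  fixes f :: "'a::alg_closed_field^'n \<Rightarrow> 'a" and \<gamma> :: "'a poly^'n"
  assumes f: "f \<in> poly_funs UNIV vec_coords" and h: "h \<noteq> 0"
    and vanish: "\<And>\<epsilon>. poly h \<epsilon> \<noteq> 0 \<Longrightarrow> f (vmap (\<lambda>p. poly p \<epsilon>) \<gamma>) = 0"
  shows "f (vmap (\<lambda>p. poly p \<epsilon>) \<gamma>) = 0"
proof -
  have hom: "comm_ring_map (\<lambda>p. poly p \<epsilon>)" for \<epsilon> :: 'a
    by unfold_locales simp_all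
  obtain p where p: "\<And>\<epsilon>. poly p \<epsilon> = f (vmap (\<lambda>p. poly p \<epsilon>) \<gamma>)"
    using poly_funs_pullback[OF f, of "\<lambda>\<epsilon> p. poly p \<epsilon>" "\<lambda>c. [:c:]" \<gamma>] hom by auto
  have "p = 0"
    using h vanish by (intro poly_eq_0_cofinite[of "{\<epsilon>. poly h \<epsilon> = 0}"]) (auto simp: p poly_roots_finite)
  then show ?thesis using p[of \<epsilon>] by simp
qed

text \<open>The vectors \<open>a \<times>\<^sub>c x\<close>, \<open>m \<times>\<^sub>c x\<close>,
  \<open>n \<times>\<^sub>c x\<close> are orthogonal to \<open>x\<close>, so for nonzero
  \<open>x\<close> they are dependent and their mixed product is zero. This is the polarisation of
  that cubic identity at \<open>c\<close>, \<open>c\<close>, \<open>q\<close>.\<close>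

lemma limb_row_cross_identity:
  fixes a c q m n :: "'a::comm_ring_1^3"
  shows "(a \<times>\<^sub>c c) \<cdot> ((m \<times>\<^sub>c q) \<times>\<^sub>c (n \<times>\<^sub>c c) + (m \<times>\<^sub>c c) \<times>\<^sub>c (n \<times>\<^sub>c q))
    + (a \<times>\<^sub>c q) \<cdot> ((m \<times>\<^sub>c c) \<times>\<^sub>c (n \<times>\<^sub>c c)) = 0"
  unfolding dot_cross_dot_cross dot_linear
  by (simp add: vec3_simps algebra_simps)

context good_platform
begin

definition vel_form :: "'a^6 \<Rightarrow> 'a^6 \<Rightarrow> 'a" where
  "vel_form s t = angular s \<cdot> vel t + angular t \<cdot> vel s"

definition power_form :: "'a^6 \<Rightarrow> 'a^6 \<Rightarrow> 'a" where
  "power_form s t = angular s \<cdot> linear_part t + angular t \<cdot> linear_part s"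

abbreviation "qf t \<equiv> angular t \<cdot> vel t"

lemma qf_add: "qf (s + t) = qf s + vel_form s t + qf t"
  by (simp add: vel_form_def)

lemma qf_scale: "qf (c *s t) = c * (c * qf t)"
  by simp

lemma vel_form_linear: "vel_form s (t + u) = vel_form s t + vel_form s u"
    "vel_form s (c *s t) = c * vel_form s t" "vel_form (c *s s) t = c * vel_form s t"
  by (simp_all add: vel_form_def algebra_simps)

lemma power_add: "power_of (s + t) = power_of s + power_form s t + power_of t"
  by (simp add: power_of_def power_form_def)

lemma power_form_linear: "power_form s (t + u) = power_form s t + power_form s u"
    "power_form s (c *s t) = c * power_form s t" "power_form (c *s s) t = c * power_form s t"
  by (simp_all add: power_form_def algebra_simps)

lemma power_rec_twist: "power_of (rec_twist P 2 3) = \<delta> * pitch A C P 1"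
  by (simp add: power_of_def rec_twist_def pitch_def Let_def normal_def rows_def)

lemma cubic_0: "cubic 0 = 0"
  by (simp add: cubic_def rows_def base_row_def)

text \<open>
  With \<open>y\<close> orthogonal to \<open>M\<close>, the second point of the quadric on the line through \<open>M\<close> and \<open>T + \<epsilon>y\<close>
  moves from \<open>T\<close> at \<open>\<epsilon> = 0\<close> to \<open>M\<close> at \<open>\<epsilon> = \<infinity>\<close>. If \<open>T\<close> is orthogonal to \<open>M\<close>, then the line through
  \<open>T\<close> and \<open>M\<close> lies on the quadric.
\<close>

lemma quadric_density:
  assumes f: "f \<in> forms UNIV d"
    and vanish: "\<And>t. on_quadric t \<Longrightarrow> power_of t \<noteq> 0 \<Longrightarrow> f t = 0" and T: "on_quadric T"
  shows "f T = 0"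
proof -
  have f_poly: "f \<in> poly_funs UNIV vec_coords" and f_hom: "f (c *s v) = c ^ d * f v" for c v
    using f by (auto simp: forms_iff)
  define M where "M = rec_twist 0 2 3"
  define N where "N = row_offset A C 3 \<times>\<^sub>c row_offset A C 4"
  define y where "y = twist (tangent_angular A C) (tangent_linear A C)"
  have M_rec: "reciprocal A C 0 M" unfolding M_def by (rule rec_twist_reciprocal[OF cubic_0])
  have M_vel: "vel M = 0" using reciprocal_velocity[OF M_rec] by simp
  have M_ang: "angular M = \<delta> *s N"
    by (simp add: M_def rec_twist_def normal_def rows_def limb_row_def N_def)
  have M_res: "residual_form A C 5 M = 0" "residual_form A C 6 M = 0"
    using reciprocal_on_quadric[OF M_rec] by (simp_all add: on_quadric_def)
  have M_power: "power_of M \<noteq> 0" using nonzero(2,5) by (simp add: M_def power_rec_twist)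
  define V where "V = - ((A$2 \<cdot> moment_residual A C 5) *s dual5 A C + (A$2 \<cdot> moment_residual A C 6) *s dual6 A C)"
  define \<alpha> \<beta> where "\<alpha> = N \<cdot> velocity A C 0 (V0 A C)" and "\<beta> = N \<cdot> velocity A C (\<delta> *s A$2) V"
  have y_lin: "linear_part y = \<alpha> *s V - \<beta> *s V0 A C"
    by (simp add: y_def tangent_linear_def Let_def V_def N_def \<alpha>_def \<beta>_def)
  have y_ang: "angular y = \<alpha> *s (\<delta> *s A$2) - \<beta> *s 0"
    by (simp add: y_def tangent_angular_def N_def \<alpha>_def)
  have "N \<cdot> vel y = 0"
    unfolding y_lin y_ang velocity_linear by (simp add: \<alpha>_def \<beta>_def)
  then have My: "vel_form M y = 0" unfolding vel_form_def M_vel by (simp add: M_ang)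
  have y_res: "residual_form A C 5 y = 0" "residual_form A C 6 y = 0"
    unfolding residual_form_def y_lin y_ang
    by (simp_all add: V_def dot_p dot_commute[of "A$2"])
  have y_qf: "qf y \<noteq> 0" using nonzero(8) by (simp add: y_def)
  have T_res: "residual_form A C 5 T = 0" "residual_form A C 6 T = 0" and T_qf: "qf T = 0"
    using T by (simp_all add: on_quadric_def)
  show ?thesis
  proof (cases "vel_form M T = 0")
    case True
    define \<gamma> :: "'a poly^6" where "\<gamma> = (\<chi> i. [:T$i, M$i:])"
    define h where "h = [:power_of T, power_form T M, power_of M:]"
    have \<gamma>: "vmap (\<lambda>p. poly p \<epsilon>) \<gamma> = T + \<epsilon> *s M" for \<epsilon>
      by (simp add: \<gamma>_def vec_eq_iff)
    have "on_quadric (T + \<epsilon> *s M)" for \<epsilon>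
      using True unfolding on_quadric_def qf_add qf_scale
      by (simp add: T_res M_res T_qf M_vel vel_form_def)
    moreover have "power_of (T + \<epsilon> *s M) = poly h \<epsilon>" for \<epsilon>
      unfolding power_add power_form_linear power_of_scale h_def by (simp add: algebra_simps power2_eq_square)
    ultimately have "f (vmap (\<lambda>p. poly p \<epsilon>) \<gamma>) = 0" if "poly h \<epsilon> \<noteq> 0" for \<epsilon>
      unfolding \<gamma> using that by (intro vanish) simp_all
    moreover have "h \<noteq> 0" using M_power by (simp add: h_def)
    ultimately have "f (vmap (\<lambda>p. poly p 0) \<gamma>) = 0" using poly_path_vanishing[OF f_poly] by blast
    then show ?thesis by (simp add: \<gamma>)
  next
    case False
    define b where "b = vel_form M T"
    \<comment> \<open>\<open>\<sigma>\<close> is the value of \<open>qf\<close> at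
      \<open>T + \<epsilon> *s y\<close>. Since \<open>qf M = 0\<close> and
      \<open>vel_form M (T + \<epsilon> *s y) = b\<close>, the combination
      \<open>\<sigma> *s M - b *s (T + \<epsilon> *s y)\<close> lies on the quadric.\<close>
    define \<sigma> where "\<sigma> = [:0, vel_form T y, qf y:]"
    define \<gamma> :: "'a poly^6" where "\<gamma> = (\<chi> i. Polynomial.smult (M$i) \<sigma> - Polynomial.smult b [:T$i, y$i:])"
    define w where "w \<epsilon> = - b *s (T + \<epsilon> *s y)" for \<epsilon>
    have \<gamma>: "vmap (\<lambda>p. poly p \<epsilon>) \<gamma> = poly \<sigma> \<epsilon> *s M + w \<epsilon>" for \<epsilon>
      by (simp add: \<gamma>_def w_def vec_eq_iff algebra_simps)
    have quad: "on_quadric (poly \<sigma> \<epsilon> *s M + w \<epsilon>)" for \<epsilon>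
    proof -
      have qf1: "qf (T + \<epsilon> *s y) = poly \<sigma> \<epsilon>"
        unfolding qf_add qf_scale vel_form_linear by (simp add: T_qf \<sigma>_def algebra_simps)
      have "qf (w \<epsilon>) = - b * (- b * poly \<sigma> \<epsilon>)" unfolding w_def qf_scale qf1 ..
      moreover have "vel_form M (w \<epsilon>) = - b * b"
        unfolding w_def vel_form_linear My by (simp add: b_def)
      ultimately have "qf (poly \<sigma> \<epsilon> *s M + w \<epsilon>) = poly \<sigma> \<epsilon> * (- b * b) + - b * (- b * poly \<sigma> \<epsilon>)"
        unfolding qf_add[of _ "w \<epsilon>"] vel_form_linear(3) by (simp add: M_vel)
      then have "qf (poly \<sigma> \<epsilon> *s M + w \<epsilon>) = 0" by simp
      then show ?thesis
        unfolding on_quadric_def residual_form_linear w_def by (simp add: M_res T_res y_res)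
    qed
    define n0 n1 where "n0 = power_form M (- b *s T)" and "n1 = power_form M (- b *s y)"
    define h0 h1 h2 where "h0 = b * b * power_of T" and "h1 = b * b * power_form T y" and "h2 = b * b * power_of y"
    \<comment> \<open>The power along the path; its coefficient of degree 4 is nonzero because
      neither \<open>qf y\<close> nor \<open>power_of M\<close> vanishes.\<close>
    define h where "h = [:h0, h1 + vel_form T y * n0, vel_form T y * vel_form T y * power_of M + vel_form T y * n1 + qf y * n0 + h2,
      2 * vel_form T y * qf y * power_of M + qf y * n1, qf y * qf y * power_of M:]"
    have power: "power_of (poly \<sigma> \<epsilon> *s M + w \<epsilon>) = poly h \<epsilon>" for \<epsilon>
      unfolding power_add power_form_linear power_of_scale w_def h_def \<sigma>_def n0_def n1_def h0_def h1_def h2_def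
      by (simp add: algebra_simps power2_eq_square)
    have "f (vmap (\<lambda>p. poly p \<epsilon>) \<gamma>) = 0" if "poly h \<epsilon> \<noteq> 0" for \<epsilon>
      unfolding \<gamma> by (rule vanish[OF quad]) (simp add: that power)
    moreover have "h \<noteq> 0" using M_power y_qf by (simp add: h_def)
    ultimately have "f (vmap (\<lambda>p. poly p 0) \<gamma>) = 0" using poly_path_vanishing[OF f_poly] by blast
    then have "f (- b *s T) = 0" by (simp add: \<gamma> \<sigma>_def w_def)
    then have "(- b) ^ d * f T = 0" unfolding f_hom .
    then show ?thesis using False by (simp add: b_def)
  qed
qed

section \<open>Density of the open set in the singularity surface\<close>

lemma pitch_scale: "pitch A C (c *s P) (c * z) = c ^ 5 * pitch A C P z"
proof -
  have row: "limb_row A C i (c *s P) (c * z) = c *s limb_row A C i P z" for i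
    by (simp add: limb_row_def vec_eq_iff algebra_simps)
  have lin: "lin A C (c *s P) (c * z) \<Omega> = c *s lin A C P z \<Omega>" for \<Omega>
    by (simp add: lin_def vec_eq_iff algebra_simps)
  show ?thesis
    unfolding pitch_def Let_def row lin cross_linear lin_scale dot_linear by (simp add: power_def algebra_simps)
qed

definition line_coeff1 :: "'a^3 \<Rightarrow> 'a" where
  "line_coeff1 P = (\<delta> *s (moments A C$2 + A$2 \<times>\<^sub>c P) + (P \<cdot> V0 A C) *s moments A C$2) \<cdot> normal P 2 3
     + rows P $ 1 \<cdot> (rows P $ 2 \<times>\<^sub>c (row_slope A C 4 \<times>\<^sub>c C$2) + (row_slope A C 3 \<times>\<^sub>c C$2) \<times>\<^sub>c rows P $ 3)"

definition line_coeff2 :: "'a^3 \<Rightarrow> 'a" where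
  "line_coeff2 P = (\<delta> *s moments A C$2) \<cdot> normal P 2 3
     + (\<delta> *s (moments A C$2 + A$2 \<times>\<^sub>c P) + (P \<cdot> V0 A C) *s moments A C$2) \<cdot>
       (rows P $ 2 \<times>\<^sub>c (row_slope A C 4 \<times>\<^sub>c C$2) + (row_slope A C 3 \<times>\<^sub>c C$2) \<times>\<^sub>c rows P $ 3)
     + rows P $ 1 \<cdot> ((row_slope A C 3 \<times>\<^sub>c C$2) \<times>\<^sub>c (row_slope A C 4 \<times>\<^sub>c C$2))"

text \<open>The base row is quadratic in \<open>v\<close>, so degree 4 is possible at first sight;
  that coefficient is zero since it is the mixed product of three vectors orthogonal to
  \<open>C$2\<close>. The polarised identity removes \<open>P\<close> from the coefficient of degree
  3.\<close>

lemma cubic_on_line: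
  "cubic (P + v *s C$2) = cubic P + line_coeff1 P * v + line_coeff2 P * v\<^sup>2 + \<delta> * line_lead A C * v ^ 3"
proof -
  define m where "m = moments A C $ 2"
  define B where "B = \<delta> *s (m + A$2 \<times>\<^sub>c P) + (P \<cdot> V0 A C) *s m"
  define R1 R3 R4 where R: "R1 = rows P $ 1" "R3 = rows P $ 2" "R4 = rows P $ 3"
  define d3 d4 where d: "d3 = row_slope A C 3 \<times>\<^sub>c C$2" "d4 = row_slope A C 4 \<times>\<^sub>c C$2"
  have m: "m = A$2 \<times>\<^sub>c C$2" by (simp add: m_def moments_def)
  have r1: "rows (P + v *s C$2) $ 1 = R1 + v *s B + (v * v) *s (\<delta> *s m)"
    by (simp add: R rows_def base_row_def B_def m dot_p m_def[symmetric] vec_eq_iff algebra_simps)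
  have r3: "rows (P + v *s C$2) $ 2 = R3 + v *s d3" and r4: "rows (P + v *s C$2) $ 3 = R4 + v *s d4"
    by (simp_all add: R rows_def limb_row_def d vec_eq_iff algebra_simps)
  define N X1 X2 where NX: "N = R3 \<times>\<^sub>c R4" "X1 = R3 \<times>\<^sub>c d4 + d3 \<times>\<^sub>c R4" "X2 = d3 \<times>\<^sub>c d4"
  have n: "rows (P + v *s C$2) $ 2 \<times>\<^sub>c rows (P + v *s C$2) $ 3 = N + v *s X1 + (v * v) *s X2"
    unfolding r3 r4 NX by (simp add: vec_eq_iff algebra_simps)
  have mX2: "m \<cdot> X2 = 0"
    by (simp add: NX d m cross_cross_left)
  have top: "m \<cdot> X1 + (A$2 \<times>\<^sub>c P) \<cdot> X2 = line_lead A C"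
  proof -
    have "m \<cdot> X1 + (A$2 \<times>\<^sub>c P) \<cdot> X2 = m \<cdot> (d3 \<times>\<^sub>c row_offset A C 4 + row_offset A C 3 \<times>\<^sub>c d4)
      + (m \<cdot> ((row_slope A C 3 \<times>\<^sub>c P) \<times>\<^sub>c d4 + d3 \<times>\<^sub>c (row_slope A C 4 \<times>\<^sub>c P)) + (A$2 \<times>\<^sub>c P) \<cdot> (d3 \<times>\<^sub>c d4))"
      by (simp add: NX R rows_def limb_row_def algebra_simps)
    then show ?thesis unfolding d m limb_row_cross_identity by (simp add: line_lead_def moments_def)
  qed
  have "cubic (P + v *s C$2) = R1 \<cdot> N + (B \<cdot> N + R1 \<cdot> X1) * v + ((\<delta> *s m) \<cdot> N + B \<cdot> X1 + R1 \<cdot> X2) * v\<^sup>2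
     + (\<delta> * (m \<cdot> X1) + B \<cdot> X2) * v ^ 3 + \<delta> * (m \<cdot> X2) * v ^ 4"
    unfolding cubic_def normal_def n r1 by (simp add: algebra_simps power2_eq_square eval_nat_numeral)
  moreover have "\<delta> * (m \<cdot> X1) + B \<cdot> X2 = \<delta> * line_lead A C"
    unfolding top[symmetric] by (simp add: B_def mX2 algebra_simps)
  moreover have "cubic P = R1 \<cdot> N" "line_coeff1 P = B \<cdot> N + R1 \<cdot> X1"
    "line_coeff2 P = (\<delta> *s m) \<cdot> N + B \<cdot> X1 + R1 \<cdot> X2"
    by (simp_all only: line_coeff1_def line_coeff2_def cubic_def normal_def R NX d B_def m_def)
  ultimately show ?thesis unfolding mX2 by simp
qed

text \<open>On this line the cubic splits into three linear factors, and \<open>discr\<close>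
  contains the pitch at each zero; homogeneity clears the denominator of the third.\<close>

lemma pitch_on_line:
  assumes "cubic (v *s C$2) = 0" shows "pitch A C (v *s C$2) 1 \<noteq> 0"
proof -
  have "line_coeff1 0 = \<delta> * line_const A C" "line_coeff2 0 = \<delta> * (line_const A C + line_lead A C)"
    by (simp_all add: line_coeff1_def line_coeff2_def line_const_def line_lead_def rows_def normal_def base_row_def limb_row_def algebra_simps)
  then have "cubic (v *s C$2) = \<delta> * (v * ((v + 1) * (line_lead A C * v + line_const A C)))"
    using cubic_on_line[of 0 v] by (simp add: cubic_0 algebra_simps power2_eq_square eval_nat_numeral)
  then consider "v = 0" | "v = -1" | "line_lead A C * v = - line_const A C"
    using assms nonzero(2) by (auto simp: eq_neg_iff_add_eq_0)
  then show ?thesis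
  proof cases
    case 3
    have "line_lead A C ^ 5 * pitch A C (v *s C$2) 1 = pitch A C (- line_const A C *s C$2) (line_lead A C)"
      unfolding pitch_scale[symmetric] by (simp add: 3)
    then show ?thesis using nonzero(7) by auto
  qed (use nonzero(5,6) in auto)
qed

text \<open>Everything is pulled back along \<open>(u, v) \<mapsto> u *s P + v *s C$2\<close>, where
  \<open>P\<close> is the point \<open>(1, 0)\<close>. The cubic has a nonzero constant leading
  coefficient in \<open>v\<close>, and on \<open>u = 0\<close> it has no common zero with the
  pitch.\<close>

lemma surface_density:
  assumes f: "f \<in> poly_funs UNIV vec_coords"
    and vanish: "\<And>P. cubic P = 0 \<Longrightarrow> pitch A C P 1 \<noteq> 0 \<Longrightarrow> f P = 0" and P: "cubic P = 0"
  shows "f P = 0"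
proof -
  define \<gamma> :: "'a poly poly^3" where "\<gamma> = (\<chi> i. [:[:0, P$i:], [:C$2$i:]:])"
  have \<gamma>: "vmap (poly2 (u, v)) \<gamma> = u *s P + v *s C$2" for u v
    by (simp add: \<gamma>_def vec_eq_iff poly2_def)
  have pull: "\<exists>p. \<forall>u v. poly2 (u, v) p = g (u *s P + v *s C$2)"
    if "g \<in> poly_funs UNIV vec_coords" for g
    using poly_funs_pullback[OF that, of poly2 "\<lambda>c. [:[:c:]:]" \<gamma>] comm_ring_map_poly2
    by (auto simp: \<gamma>[symmetric] poly2_def)
  have pull1: "\<exists>p. \<forall>u. poly p u = g (u *s P)" if "g \<in> poly_funs UNIV vec_coords" for g
  proof -
    have "vmap (\<lambda>p. poly p u) (\<chi> i. [:0, P$i:]) = u *s P" for u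
      by (simp add: vec_eq_iff)
    moreover have "comm_ring_map (\<lambda>p. poly p u)" for u :: 'a by unfold_locales simp_all
    ultimately show ?thesis
      using poly_funs_pullback[OF that, of "\<lambda>u p. poly p u" "\<lambda>c. [:c:]" "\<chi> i. [:0, P$i:]"] by auto
  qed
  obtain p where p: "\<And>u v. poly2 (u, v) p = f (u *s P + v *s C$2)"
    using pull[OF f] by blast
  have "(\<lambda>P. pitch A C P 1) \<in> poly_funs UNIV vec_coords"
  proof -
    have "(\<lambda>P. normal P 2 3 \<cdot> lin A C P 1 (normal P 2 3)) \<in> poly_funs k vec_coords"
      unfolding lin_def by (intro k_intros k_normal)
    moreover have "(\<lambda>P. normal P 2 3 \<cdot> lin A C P 1 (normal P 2 3)) = (\<lambda>P. pitch A C P 1)"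
      by (simp add: pitch_def Let_def normal_def rows_def)
    ultimately show ?thesis using poly_funs_mono by fastforce
  qed
  then obtain h where h: "\<And>u v. poly2 (u, v) h = pitch A C (u *s P + v *s C$2) 1"
    using pull by blast
  have "line_coeff1 \<in> poly_funs k vec_coords" "line_coeff2 \<in> poly_funs k vec_coords"
    unfolding line_coeff1_def[abs_def] line_coeff2_def[abs_def] by (intro k_intros k_rows k_normal)+
  then have "cubic \<in> poly_funs UNIV vec_coords" "line_coeff1 \<in> poly_funs UNIV vec_coords" "line_coeff2 \<in> poly_funs UNIV vec_coords"
    using poly_funs_mono k_cubic by blast+
  then obtain q0 q1 q2 where q: "\<And>u. poly q0 u = cubic (u *s P)" "\<And>u. poly q1 u = line_coeff1 (u *s P)"
    "\<And>u. poly q2 u = line_coeff2 (u *s P)"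
    using pull1 by meson
  define c where "c = [:q0, q1, q2, [:\<delta> * line_lead A C:]:]"
  have c: "poly2 (u, v) c = cubic (u *s P + v *s C$2)" for u v
    unfolding cubic_on_line by (simp add: c_def poly2_def q algebra_simps power2_eq_square eval_nat_numeral)
  have "poly2 (1, 0) p = 0"
  proof (rule plane_curve_density)
    show "lead_coeff c = [:\<delta> * line_lead A C:]" "\<delta> * line_lead A C \<noteq> 0"
      using nonzero(2,4) by (simp_all add: c_def)
    show "poly2 (1, 0) c = 0" using P by (simp add: c)
    show "poly2 (0, v) h \<noteq> 0" if "poly2 (0, v) c = 0" for v
      using that pitch_on_line[of v] by (simp add: c h)
    show "poly2 (u, v) p = 0" if "poly2 (u, v) c = 0" "poly2 (u, v) h \<noteq> 0" for u v
      using that vanish by (simp add: c h p)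
  qed
  then show ?thesis by (simp add: p)
qed

lemma Q_open_dense: "dense_open proj_closed k Q_open Q"
  unfolding dense_open_def
proof (intro conjI allI impI Q_open_open subsetI)
  fix Z L assume Z: "proj_closed UNIV Z \<and> Q_open \<subseteq> Z" and L: "L \<in> Q"
  then obtain F where F: "F \<subseteq> (\<Union>d. forms UNIV d)" "Z = {L \<in> proj_space. \<forall>f\<in>F. \<forall>v\<in>L. f v = 0}"
    by (auto simp: proj_closed_def)
  have "f v = 0" if "f \<in> F" "v \<in> L" for f v
  proof -
    obtain d where d: "f \<in> forms UNIV d" using F(1) \<open>f \<in> F\<close> by blast
    show ?thesis
    proof (rule quadric_density[OF d])
      show "on_quadric v" using L that(2) by (simp add: Q_def)
      fix t assume t: "on_quadric t" "power_of t \<noteq> 0"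
      then have "t \<noteq> 0" by auto
      have r: "reciprocal A C (inv_point t) t" using inv_point_reciprocal t .
      have c: "cubic (inv_point t) = 0" using cubic_eq_0[OF r \<open>t \<noteq> 0\<close>] .
      have "Rec A C (inv_point t) \<in> Q" using Rec_in_Q c by (simp add: surface_iff)
      then have "Rec A C (inv_point t) \<in> Q_open" using r t(2) by (auto simp: Q_open_def Rec_def)
      then have "Rec A C (inv_point t) \<in> Z" using Z by blast
      then show "f t = 0" using r F(2) \<open>f \<in> F\<close> by (auto simp: Rec_def)
    qed
  qed
  then show "L \<in> Z" using L F(2) by (simp add: Q_def)
qed

lemma surface_open_dense: "dense_open affine_closed k surface_open (singularity_surface A C)"
  unfolding dense_open_def
proof (intro conjI allI impI surface_open_open subsetI)
  fix Z P assume Z: "affine_closed UNIV Z \<and> surface_open \<subseteq> Z" and P: "P \<in> singularity_surface A C"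
  then obtain F where F: "F \<subseteq> poly_funs UNIV vec_coords" "Z = {x. \<forall>f\<in>F. f x = 0}"
    by (auto simp: affine_closed_def)
  have "f P = 0" if f: "f \<in> F" for f
  proof (rule surface_density)
    show "f \<in> poly_funs UNIV vec_coords" using F(1) f by blast
    show "cubic P = 0" using P by (simp add: surface_iff)
    fix x assume x: "cubic x = 0" "pitch A C x 1 \<noteq> 0"
    have "rec_twist x 2 3 \<in> Rec A C x" using rec_twist_reciprocal[OF x(1)] by (simp add: Rec_def)
    moreover have "power_of (rec_twist x 2 3) \<noteq> 0" using x(2) nonzero(2) by (simp add: power_rec_twist)
    ultimately have "x \<in> surface_open"
      using Rec_in_Q x(1) by (auto simp: surface_open_def Q_open_def surface_iff)
    then show "f x = 0" using Z F(2) f by blast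
  qed
  then show "P \<in> Z" using F(2) by simp
qed

lemma Rec_birational:
  assumes "A$5 = (\<Sum>i\<in>{2,3,4}. \<alpha> i *s A$i)" "A$6 = (\<Sum>i\<in>{2,3,4}. \<beta> i *s A$i)"
  shows "birational_equivalence k (singularity_surface A C) (quadric \<alpha> \<beta> A C) (Rec A C)"
  unfolding birational_equivalence_def quadric_eq[OF assms]
proof (intro conjI exI)
  have pt: "Rec A C (inverse_map L) = L \<and> inverse_map L \<in> surface_open" if L: "L \<in> Q_open" for L
  proof -
    have "L \<in> proj_space" using L by (simp add: Q_open_def Q_def)
    then obtain v where v: "v \<in> L" "v \<noteq> 0" using proj_space_nonzero by blast
    show ?thesis using Q_open_point[OF L v] L by (simp add: surface_open_def)
  qed
  show "inverse_map ` Q_open \<subseteq> surface_open" "\<forall>L\<in>Q_open. Rec A C (inverse_map L) = L"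
    using pt by auto
  show "Rec A C ` surface_open \<subseteq> Q_open" by (auto simp: surface_open_def)
  show "\<forall>P\<in>surface_open. inverse_map (Rec A C P) = P"
  proof
    fix P assume "P \<in> surface_open"
    then have L: "Rec A C P \<in> Q_open" by (simp add: surface_open_def)
    then obtain v where v: "v \<in> Rec A C P" "v \<noteq> 0"
      using proj_space_nonzero by (auto simp: Q_open_def Q_def)
    show "inverse_map (Rec A C P) = P"
      using Q_open_point(1,3)[OF L v] inv_point_unique[of P v] v(1) by (simp add: Rec_def)
  qed
qed (use surface_closed Q_closed Rec_regular Rec_in_Q surface_open_dense Q_open_dense inverse_map_regular in auto)

end

section \<open>Generic platforms\<close>

text \<open>
  Evaluating \<open>discr\<close> in this ring shows that it is a polynomial function of the architecture.
\<close>

typedef platform_poly = "poly_funs UNIV platform_coords :: ((real^3^6) \<times> (real^3^6) \<Rightarrow> real) set"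
  by (rule exI[of _ "\<lambda>_. 0"]) (rule poly_funs.const, simp)

setup_lifting type_definition_platform_poly

instantiation platform_poly :: comm_ring_1
begin

lift_definition zero_platform_poly :: platform_poly is "\<lambda>_. 0" by (rule poly_funs.const) simp
lift_definition one_platform_poly :: platform_poly is "\<lambda>_. 1" by (rule poly_funs.const) simp
lift_definition plus_platform_poly :: "platform_poly \<Rightarrow> platform_poly \<Rightarrow> platform_poly" is "\<lambda>f g x. f x + g x"
  by (rule poly_funs.add)
lift_definition times_platform_poly :: "platform_poly \<Rightarrow> platform_poly \<Rightarrow> platform_poly" is "\<lambda>f g x. f x * g x"
  by (rule poly_funs.mult)
lift_definition uminus_platform_poly :: "platform_poly \<Rightarrow> platform_poly" is "\<lambda>f x. - f x"
  by (rule poly_funs_uminus) simp_all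
lift_definition minus_platform_poly :: "platform_poly \<Rightarrow> platform_poly \<Rightarrow> platform_poly" is "\<lambda>f g x. f x - g x"
  by (rule poly_funs_diff) simp_all

instance
proof
  show "(0::platform_poly) \<noteq> 1" by transfer (metis zero_neq_one)
qed (transfer; simp add: algebra_simps)+

end

lift_definition platform_A :: "6 \<Rightarrow> 3 \<Rightarrow> platform_poly" is "\<lambda>i j (A, b). A $ i $ j"
  by (rule poly_funs.coord) (auto simp: platform_coords_def)
lift_definition platform_b :: "6 \<Rightarrow> 3 \<Rightarrow> platform_poly" is "\<lambda>i j (A, b). b $ i $ j"
  by (rule poly_funs.coord) (auto simp: platform_coords_def)

lemma discr_polynomial:
  "(\<lambda>(A, b). discr A (b - A)) \<in> poly_funs UNIV platform_coords"
proof -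
  define d where "d = discr (\<chi> i j. platform_A i j) (\<chi> i j. platform_b i j - platform_A i j)"
  have "Rep_platform_poly d (A, b) = discr A (b - A)" for A b
  proof -
    interpret comm_ring_map "\<lambda>f. Rep_platform_poly f (A, b)"
      by unfold_locales (transfer, simp)+
    have "mmap (\<lambda>f. Rep_platform_poly f (A, b)) (\<chi> i j. platform_A i j) = A"
      "mmap (\<lambda>f. Rep_platform_poly f (A, b)) (\<chi> i j. platform_b i j - platform_A i j) = b - A"
      by (simp_all add: vec_eq_iff platform_A.rep_eq platform_b.rep_eq)
    then show ?thesis by (simp add: d_def discr_hom)
  qed
  then have "(\<lambda>(A, b). discr A (b - A)) = Rep_platform_poly d" by auto
  then show ?thesis using Rep_platform_poly[of d] by simp
qed

section \<open>Passage to the function field of SO(3) and its algebraic closure\<close>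

lemma Fract_1:
  fixes x y :: "'a::idom"
  shows "Fract (x + y) 1 = Fract x 1 + Fract y 1" "Fract (x - y) 1 = Fract x 1 - Fract y 1"
    "Fract (x * y) 1 = Fract x 1 * Fract y 1"
  by simp_all

instance alg_closure :: (field) field_gcd ..

definition so3_embed :: "so3_ring \<Rightarrow> K alg_closure" where "so3_embed x = to_ac (Fract x 1)"

lemma so3_embed_hom: "comm_ring_map so3_embed"
  by unfold_locales (simp_all add: so3_embed_def One_fract_def flip: to_ac_add to_ac_mult to_ac_1)

lemma so3_embed_eq_0: "so3_embed x = 0 \<longleftrightarrow> x = 0"
  by (simp add: so3_embed_def Zero_fract_def eq_fract)

lemma so3_const_hom: "comm_ring_map so3_const"
  by unfold_locales (transfer, simp)+

definition so3_A :: "real^3^6 \<Rightarrow> so3_ring^3^6" where "so3_A A = mmap so3_const A"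

definition so3_C :: "real^3^6 \<Rightarrow> real^3^6 \<Rightarrow> so3_ring^3^6" where
  "so3_C A b = (\<chi> i. (\<chi> r c. so3_entry r c) *v vmap so3_const (b$i) - vmap so3_const (A$i))"

lemma extend_base_points: "extend_scalars (base_points A) = mmap so3_embed (so3_A A)"
  by (simp add: vec_eq_iff extend_scalars_def base_points_def K_vec_def K_of_real_def so3_A_def so3_embed_def)

lemma extend_limb_vectors: "extend_scalars (limb_vectors A b) = mmap so3_embed (so3_C A b)"
proof -
  interpret comm_ring_map so3_embed by (rule so3_embed_hom)
  have "to_ac (limb_vectors A b $ i $ j) = so3_embed (so3_C A b $ i $ j)" for i j
    by (simp add: limb_vectors_def so3_C_def matrix_vector_mult_def sum_3 generic_rotation_def K_vec_def
        K_of_real_def) (simp add: so3_embed_def Fract_1 del: add_fract diff_fract mult_fract)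
  then show ?thesis by (simp add: vec_eq_iff extend_scalars_def)
qed

text \<open>Evaluation at the identity rotation is a ring homomorphism that sends
  \<open>so3_C A b\<close> to \<open>b - A\<close>.\<close>

lemma discr_so3_nonzero:
  assumes "discr A (b - A) \<noteq> 0" shows "discr (so3_A A) (so3_C A b) \<noteq> 0"
proof
  assume 0: "discr (so3_A A) (so3_C A b) = 0"
  define I where "I = Abs_so3 (mat 1)"
  have I: "Rep_so3 I = mat 1"
    unfolding I_def by (rule Abs_so3_inverse) (simp add: rotation_matrix_def orthogonal_matrix_id)
  interpret comm_ring_map "\<lambda>f. so3_fun f I" by unfold_locales (transfer, simp)+
  have "mmap (\<lambda>f. so3_fun f I) (so3_A A) = A"
    by (simp add: vec_eq_iff so3_A_def so3_const.rep_eq)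
  moreover have "mmap (\<lambda>f. so3_fun f I) (so3_C A b) = b - A"
    by (simp add: vec_eq_iff forall_3 so3_C_def matrix_vector_mult_def sum_3 so3_const.rep_eq so3_entry.rep_eq I mat_def)
  ultimately have "discr A (b - A) = so3_fun 0 I"
    using discr_hom[of "so3_A A" "so3_C A b"] 0 by simp
  then show False using assms by simp
qed

theorem theorem8:
  shows "generic_platform (\<lambda>A b. \<forall>\<alpha> \<beta> :: 6 \<Rightarrow> real.
    A$5 = (\<Sum>i\<in>{2,3,4}. \<alpha> i *\<^sub>R A$i) \<and> A$6 = (\<Sum>i\<in>{2,3,4}. \<beta> i *\<^sub>R A$i) \<longrightarrow>
    (let A' = extend_scalars (base_points A);
         C' = extend_scalars (limb_vectors A b);
         \<alpha>' = (\<lambda>i. to_ac (K_of_real (\<alpha> i)));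
         \<beta>' = (\<lambda>i. to_ac (K_of_real (\<beta> i)))
     in birational_equivalence (range (to_ac :: K \<Rightarrow> K alg_closure))
          (singularity_surface A' C') (quadric \<alpha>' \<beta>' A' C') (Rec A' C')))"
proof -
  have birational: "birational_equivalence (range (to_ac :: K \<Rightarrow> K alg_closure))
      (singularity_surface (extend_scalars (base_points A)) (extend_scalars (limb_vectors A b)))
      (quadric (\<lambda>i. to_ac (K_of_real (\<alpha> i))) (\<lambda>i. to_ac (K_of_real (\<beta> i)))
        (extend_scalars (base_points A)) (extend_scalars (limb_vectors A b)))
      (Rec (extend_scalars (base_points A)) (extend_scalars (limb_vectors A b)))"
    if zero: "A$1 = 0" "b$1 = 0" and d: "discr A (b - A) \<noteq> 0"
      and \<alpha>: "A$5 = (\<Sum>i\<in>{2,3,4}. \<alpha> i *\<^sub>R A$i)" and \<beta>: "A$6 = (\<Sum>i\<in>{2,3,4}. \<beta> i *\<^sub>R A$i)"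
    for A b and \<alpha> \<beta> :: "6 \<Rightarrow> real"
  proof -
    interpret emb: comm_ring_map so3_embed by (rule so3_embed_hom)
    interpret const: comm_ring_map so3_const by (rule so3_const_hom)
    let ?A = "extend_scalars (base_points A)" and ?C = "extend_scalars (limb_vectors A b)"
    interpret good_platform "range (to_ac :: K \<Rightarrow> K alg_closure)" ?A ?C
    proof
      show "?A $ 1 = 0" using zero by (simp add: extend_base_points so3_A_def)
      show "?C $ 1 = 0" using zero by (simp add: extend_limb_vectors so3_C_def)
      show "discr ?A ?C \<noteq> 0"
        unfolding extend_base_points extend_limb_vectors emb.discr_hom[symmetric] so3_embed_eq_0
        using discr_so3_nonzero[OF d] .
      show "-1 \<in> range (to_ac :: K \<Rightarrow> K alg_closure)" by (metis rangeI to_ac_1 to_ac_minus)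
    qed (simp_all add: extend_scalars_def)
    have comb: "?A $ j = (\<Sum>i\<in>{2,3,4}. to_ac (K_of_real (\<gamma> i)) *s ?A $ i)"
      if "A $ j = (\<Sum>i\<in>{2,3,4}. \<gamma> i *\<^sub>R A $ i)" for j and \<gamma> :: "6 \<Rightarrow> real"
      unfolding extend_base_points so3_A_def K_of_real_def so3_embed_def[symmetric]
      by (simp add: that vec_eq_iff)
    show ?thesis by (rule Rec_birational[OF comb[OF \<alpha>] comb[OF \<beta>]])
  qed
  show ?thesis
    unfolding generic_platform_def Let_def
  proof (intro exI[of _ "{\<lambda>(A, b). discr A (b - A)}"] conjI)
    let ?U = "{(A :: real^3^6, b). A$1 = 0 \<and> b$1 = 0 \<and> (\<exists>f\<in>{\<lambda>(A, b). discr A (b - A)}. f (A, b) \<noteq> 0)}"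
    \<comment> \<open>The example is given by \<open>A\<close> and \<open>C = b - A\<close>, hence
      this \<open>b\<close>.\<close>
    have "(example_A, example_C + example_A) \<in> ?U"
      using discr_example by (simp add: example_A_def example_C_def)
    then show "?U \<noteq> {}" by blast
    show "{\<lambda>(A, b). discr A (b - A)} \<subseteq> poly_funs UNIV platform_coords"
      using discr_polynomial by simp
  qed (clarsimp, rule birational, simp_all)
qed

end
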